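(* Consider the randomly switched system $\dot x = f_\sigma(x)$, $x(0)=x_0$, $t\ge 0$. Suppose that there exist continuously differentiable functions $V_p:\mathbb{R}^n\to\mathbb{R}_{\ge 0}$, $p\in\mathcal{P}$, functions $\alpha_1,\alpha_2\in\mathcal{K}_\infty$, and real numbers $\widetilde\lambda,\overline\lambda,\lambda_\circ>0$, $\mu>1$, such that (i) $\alpha_1(\|x\|)\le V_p(x)\le \alpha_2(\|x\|)$ for all $x\in\mathbb{R}^n$ and all $p\in\mathcal{P}$; (ii) $\frac{\partial V_p}{\partial x}(x)f_p(x)\le -\lambda_\circ V_p(x)$ for all $x\in\mathbb{R}^n$ and all $p\in\mathcal{P}$; (iii) $V_{p_1}(x)\le \mu V_{p_2}(x)$ for all $x\in\mathbb{R}^n$ and all $p_1,p_2\in\mathcal{P}$; (iv) there exists $M\in\mathbb{N}\cup\{0\}$ such that for all $k\ge M$ and all $t\ge 0$, $\mathsf{P}(N_\sigma(t)=k)\le \dfrac{(\overline\lambda t)^k e^{-\widetilde\lambda t}}{k!}$; (v) $\mu<(\lambda_\circ+\widetilde\lambda)/\overline\lambda$. Then the system is globally asymptotically stable almost surely.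
   Context: $\|\cdot\|$ is the Euclidean norm, $\mathbb{R}_{\ge 0}=[0,\infty[$, $\mathbb{N}=\{1,2,\ldots\}$, and $0^0=1$. A continuous function $\alpha:\mathbb{R}_{\ge0}\to\mathbb{R}_{\ge0}$ is of class $\mathcal{K}$ if it is strictly increasing with $\alpha(0)=0$, and of class $\mathcal{K}_\infty$ if in addition $\alpha(r)\to\infty$ as $r\to\infty$. Setting: $\mathcal{P}=\{1,\ldots,\mathrm{N}\}$ is a finite index set; for each $p\in\mathcal{P}$, $f_p:\mathbb{R}^n\to\mathbb{R}^n$ is locally Lipschitz with $f_p(0)=0$. For every compact $K\subset\mathbb{R}_{\ge0}\times\mathbb{R}^n$ there is an integrable function $m_K$ with $\sup_{p\in\mathcal{P}}\|f_p(x)\|\le m_K(t)$ for all $(t,x)\in K$. $(\Omega,\mathfrak{F},(\mathfrak{F}_t)_{t\ge0},\mathsf{P})$ is a complete filtered probability space, and $(\mathfrak{F}_t)$ is the natural filtration (satisfying the usual conditions) generated by a càdlàg random process $\sigma$ taking values in $\mathcal{P}$ (the switching signal). The randomly switched system is $\dot x(t)=f_{\sigma(t)}(x(t))$, $x(0)=x_0$, with $x_0\in\mathbb{R}^n$ deterministic and no jumps of $x$ at the switching instants (the discontinuity times of $\sigma$). $x(\cdot)$ denotes its unique solution in the sense of Carathéodory (its existence on all of $[0,\infty[$ is a consequence of the hypotheses, not an additional assumption). $N_\sigma(t)$ is the number of switches of $\sigma$ on the interval $]0,t]$. The system is globally asymptotically stable almost surely if both of the following hold, where $x(\cdot)$ is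 the solution from initial condition $x_0$ and the implications are for all $x_0\in\mathbb{R}^n$: (SP1) $\mathsf{P}\big(\forall\varepsilon>0\ \exists\delta>0:\ \|x_0\|<\delta\Rightarrow \sup_{t\ge0}\|x(t)\|<\varepsilon\big)=1$; (SP2) $\mathsf{P}\big(\forall r,\varepsilon'>0\ \exists T\ge0:\ \|x_0\|<r\Rightarrow\sup_{t\ge T}\|x(t)\|<\varepsilon'\big)=1$. *)

theory Defs
  imports "HOL-Probability.Probability"
begin

(* Only the restriction to the nonnegative reals matters; it maps into the nonnegative reals
   by monotonicity. *)
definition class_K :: "(real \<Rightarrow> real) \<Rightarrow> bool" where
  "class_K \<alpha> \<longleftrightarrow> continuous_on {0..} \<alpha> \<and> strict_mono_on {0..} \<alpha> \<and> \<alpha> 0 = 0"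

definition class_K_inf :: "(real \<Rightarrow> real) \<Rightarrow> bool" where
  "class_K_inf \<alpha> \<longleftrightarrow> class_K \<alpha> \<and> filterlim \<alpha> at_top at_top"

definition continuously_differentiable ::
    "('a::real_normed_vector \<Rightarrow> 'b::real_normed_vector) \<Rightarrow> bool" where
  "continuously_differentiable g \<longleftrightarrow>
     (\<exists>g' :: 'a \<Rightarrow> 'a \<Rightarrow>\<^sub>L 'b.
        (\<forall>x. (g has_derivative blinfun_apply (g' x)) (at x)) \<and> continuous_on UNIV g')"

(* The library's local_lipschitz is for time-dependent maps; the time argument is a dummy here. *)
definition locally_lipschitz :: "('a::metric_space \<Rightarrow> 'b::metric_space) \<Rightarrow> bool" where
  "locally_lipschitz g \<longleftrightarrow> local_lipschitz (UNIV :: real set) UNIV (\<lambda>_. g)"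

(* A path is a function on the reals of which only the values at nonnegative times matter. *)
definition cadlag :: "(real \<Rightarrow> 'a::topological_space) \<Rightarrow> bool" where
  "cadlag s \<longleftrightarrow>
     (\<forall>t\<ge>0. (s \<longlongrightarrow> s t) (at_right t)) \<and> (\<forall>t>0. \<exists>l. (s \<longlongrightarrow> l) (at_left t))"

(* The usual augmentation (null sets added, then made right-continuous) of the
   filtration generated by the process s. *)
definition usual_natural_filtration ::
    "'w measure \<Rightarrow> (real \<Rightarrow> 'w \<Rightarrow> nat) \<Rightarrow> real \<Rightarrow> 'w set set" where
  "usual_natural_filtration M s t =
     (\<Inter>v\<in>{t<..}. sigma_sets (space M)
        ({s u -` A \<inter> space M | u A. 0 \<le> u \<and> u \<le> v} \<union> null_sets M))"

(* The number of switches on the interval from 0 (excluded) to t (included). For a cadlag path in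
   a discrete space the set of discontinuities in this interval is finite. *)
definition num_switches :: "(real \<Rightarrow> nat) \<Rightarrow> real \<Rightarrow> nat" where
  "num_switches s t = card {u \<in> {0<..t}. \<not> isCont s u}"

definition absolutely_continuous_on_interval ::
    "real \<Rightarrow> real \<Rightarrow> (real \<Rightarrow> 'a::real_normed_vector) \<Rightarrow> bool" where
  "absolutely_continuous_on_interval a b x \<longleftrightarrow>
     (\<forall>\<epsilon>>0. \<exists>\<delta>>0. \<forall>D. D division_of \<Union>D \<and> \<Union>D \<subseteq> {a..b} \<and> (\<Sum>k\<in>D. Sup k - Inf k) < \<delta>
        \<longrightarrow> (\<Sum>k\<in>D. norm (x (Sup k) - x (Inf k))) < \<epsilon>)"

(* x is a Caratheodory solution, on the whole half-line of nonnegative times, of the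
   system with vector fields f driven by the switching path s and started at x0. *)
definition caratheodory_solution ::
    "(nat \<Rightarrow> (real ^ 'n) \<Rightarrow> (real ^ 'n)) \<Rightarrow> (real \<Rightarrow> nat) \<Rightarrow> real ^ 'n \<Rightarrow> (real \<Rightarrow> real ^ 'n) \<Rightarrow> bool" where
  "caratheodory_solution f s x0 x \<longleftrightarrow>
     x 0 = x0 \<and>
     (\<forall>T\<ge>0. absolutely_continuous_on_interval 0 T x) \<and>
     (AE t in lborel. 0 < t \<longrightarrow> (x has_vector_derivative f (s t) (x t)) (at t))"

definition unique_caratheodory_solution ::
    "(nat \<Rightarrow> (real ^ 'n) \<Rightarrow> (real ^ 'n)) \<Rightarrow> (real \<Rightarrow> nat) \<Rightarrow> real ^ 'n \<Rightarrow> (real \<Rightarrow> real ^ 'n) \<Rightarrow> bool" where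
  "unique_caratheodory_solution f s x0 x \<longleftrightarrow>
     caratheodory_solution f s x0 x \<and>
     (\<forall>y. caratheodory_solution f s x0 y \<longrightarrow> (\<forall>t\<ge>0. y t = x t))"

locale randomly_switched_system = prob_space M
  for M :: "'w measure" +
  fixes F :: "real \<Rightarrow> 'w set set"
    and N :: nat
    and f :: "nat \<Rightarrow> (real ^ 'n) \<Rightarrow> (real ^ 'n)"
    and \<sigma> :: "real \<Rightarrow> 'w \<Rightarrow> nat"
  assumes complete_space: "complete_measure M"
    and N_ge_1: "1 \<le> N"
    and f_lipschitz: "\<And>p. p \<in> {1..N} \<Longrightarrow> locally_lipschitz (f p)"
    and f_zero: "\<And>p. p \<in> {1..N} \<Longrightarrow> f p 0 = 0"
    and f_bound: "\<And>K :: (real \<times> (real ^ 'n)) set. compact K \<Longrightarrow> K \<subseteq> {0..} \<times> UNIV \<Longrightarrow>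
          \<exists>m :: real \<Rightarrow> real. set_integrable lborel {0..} m \<and>
            (\<forall>(t, x)\<in>K. (SUP p\<in>{1..N}. norm (f p x)) \<le> m t)"
    and \<sigma>_measurable: "\<And>t. 0 \<le> t \<Longrightarrow> \<sigma> t \<in> measurable M (count_space {1..N})"
    and \<sigma>_cadlag: "\<And>\<omega>. \<omega> \<in> space M \<Longrightarrow> cadlag (\<lambda>t. \<sigma> t \<omega>)"
    and F_natural: "\<And>t. 0 \<le> t \<Longrightarrow> F t = usual_natural_filtration M \<sigma> t"

(* X x0 \<omega> is the trajectory started at x0. The suprema are taken in the extended reals, so that
   an unbounded trajectory has supremum infinity. *)
definition SP1 :: "'w measure \<Rightarrow> (real ^ 'n \<Rightarrow> 'w \<Rightarrow> real \<Rightarrow> real ^ 'n) \<Rightarrow> bool" where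
  "SP1 M X \<longleftrightarrow>
     measure M {\<omega> \<in> space M. \<forall>\<epsilon>>0. \<exists>\<delta>>0. \<forall>x0. norm x0 < \<delta> \<longrightarrow>
       (SUP t\<in>{0..}. ereal (norm (X x0 \<omega> t))) < ereal \<epsilon>} = 1"

definition SP2 :: "'w measure \<Rightarrow> (real ^ 'n \<Rightarrow> 'w \<Rightarrow> real \<Rightarrow> real ^ 'n) \<Rightarrow> bool" where
  "SP2 M X \<longleftrightarrow>
     measure M {\<omega> \<in> space M. \<forall>r>0. \<forall>\<epsilon>'>0. \<exists>T\<ge>0. \<forall>x0. norm x0 < r \<longrightarrow>
       (SUP t\<in>{T..}. ereal (norm (X x0 \<omega> t))) < ereal \<epsilon>'} = 1"

(* The trajectories are part of the definition: every initial condition must have a unique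
   solution, defined for all nonnegative times, along every path of the switching signal. *)
definition globally_asymptotically_stable_as ::
    "'w measure \<Rightarrow> (nat \<Rightarrow> (real ^ 'n) \<Rightarrow> (real ^ 'n)) \<Rightarrow> (real \<Rightarrow> 'w \<Rightarrow> nat) \<Rightarrow> bool" where
  "globally_asymptotically_stable_as M f \<sigma> \<longleftrightarrow>
     (\<exists>X. (\<forall>x0. \<forall>\<omega>\<in>space M. unique_caratheodory_solution f (\<lambda>t. \<sigma> t \<omega>) x0 (X x0 \<omega>))
        \<and> SP1 M X \<and> SP2 M X)"

end

theory Submission
  imports Defs
begin

text \<open>
  Fix a path \<open>s\<close> of the switching signal and a trajectory \<open>x\<close> along it. Between two switches the
  active Lyapunov function decays at rate \<open>lam0\<close>, and at a switch the newly active one exceeds the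
  old one by at most the factor \<open>\<mu>\<close>. Hence \<open>\<alpha>\<^sub>1 (norm (x t))\<close> is at most \<open>\<alpha>\<^sub>2 (norm x0)\<close> times the
  discounted gain \<open>\<mu> ^ num_switches s t * exp (- lam0 * t)\<close>
  (lemma \<open>switched_lyapunov_bound\<close>). The gain depends on the path alone, not on the initial
  condition. If it tends to \<open>0\<close> along the path, it is also bounded, and stability and attraction
  follow for that path, with \<open>\<delta>\<close> and \<open>T\<close> uniform in the initial condition.

  So only the gain is random. Summing the tail bound on the number of switches against the powers
  of \<open>\<mu>\<close> gives an exponential series: the mean gain at time \<open>t\<close> is at most
  \<open>C * exp (- lam0 * t) + exp ((\<mu> * lam_bar - lam_tilde - lam0) * t)\<close>, where \<open>C\<close> accounts for
  the finitely many switch counts without a tail bound (lemma \<open>exponential_moment_bound\<close>). The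
  condition on \<open>\<mu>\<close> says that the second exponent is negative, so the means at integer times are
  summable. Hence the gains at integer times are almost surely summable and tend to \<open>0\<close>; at any
  other time the gain is at most \<open>exp lam0\<close> times the gain at the next integer. The switch counts
  are random variables because they are limits of the number of changes seen on finer and finer
  grids (lemma \<open>num_switches_measurable\<close>).

  Trajectories have to be constructed along every path. Cutting the vector fields off outside
  a large ball makes them bounded and globally Lipschitz, so that a contraction argument gives a
  trajectory (lemma \<open>cutoff_switched_solution\<close>). A nonnegative multiple of a field along which a
  Lyapunov function decreases does not make it increase, so the cut-off trajectory obeys the bound
  above with rate \<open>0\<close> in place of \<open>lam0\<close>. The bound keeps it up to a given time in a ball that can
  be chosen in advance, and there the cut-off is invisible. Uniqueness among absolutely continuous
  functions, which are only required to satisfy the equation almost everywhere, rests on a mean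
  value inequality for such functions (lemma \<open>absolutely_continuous_mean_value_inequality\<close>); it
  also glues the trajectories on \<open>[0, n]\<close> together.
\<close>

section \<open>Switching paths\<close>

text \<open>
  Near a point, a path in a discrete space is eventually equal to its one-sided limit, so it is locally constant
  on either side. The left-hand version keeps inside the nonnegative times, where alone the path is known to be
  regular.
\<close>

lemma cadlag_eventually_right:
  fixes s :: "real \<Rightarrow> 'a::discrete_topology"
  assumes "cadlag s" "0 \<le> t"
  obtains b where "t < b" "\<And>u. t \<le> u \<Longrightarrow> u < b \<Longrightarrow> s u = s t"
proof -
  have "eventually (\<lambda>u. s u = s t) (at_right t)"
    using assms by (auto simp: cadlag_def tendsto_discrete)
  then obtain b where "t < b" "\<And>u. t < u \<Longrightarrow> u < b \<Longrightarrow> s u = s t"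
    by (auto simp: eventually_at_right_field)
  then show thesis
    by (intro that[of b]) (auto simp: order.order_iff_strict)
qed

lemma cadlag_eventually_left:
  fixes s :: "real \<Rightarrow> 'a::discrete_topology"
  assumes "cadlag s" "0 < t"
  obtains a l where "0 \<le> a" "a < t" "\<And>u. a < u \<Longrightarrow> u < t \<Longrightarrow> s u = l"
proof -
  obtain l where "(s \<longlongrightarrow> l) (at_left t)"
    using assms by (auto simp: cadlag_def)
  then have "eventually (\<lambda>u. s u = l) (at_left t)"
    by (simp add: tendsto_discrete)
  then obtain a where "a < t" "\<And>u. a < u \<Longrightarrow> u < t \<Longrightarrow> s u = l"
    by (auto simp: eventually_at_left_field)
  then show thesis
    using \<open>0 < t\<close> by (intro that[of "max 0 a" l]) auto
qed

lemma isCont_if_locally_constant: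
  fixes s :: "real \<Rightarrow> 'a::topological_space"
  assumes "a < t" "t < b" "\<And>u. a < u \<Longrightarrow> u < b \<Longrightarrow> s u = l"
  shows "isCont s t"
proof -
  have "eventually (\<lambda>u. u \<in> {a<..<b}) (nhds t)"
    using assms by (intro eventually_nhds_in_open) auto
  then have "eventually (\<lambda>u. s u = l) (nhds t)"
    by eventually_elim (use assms in auto)
  then have "isCont s t \<longleftrightarrow> isCont (\<lambda>_. l) t"
    by (rule isCont_cong)
  then show ?thesis by simp
qed

lemma isCont_locally_constantD:
  fixes s :: "real \<Rightarrow> 'a::discrete_topology"
  assumes "isCont s t"
  shows "eventually (\<lambda>u. s u = s t) (nhds t)"
proof -
  have "eventually (\<lambda>u. s u = s t) (at t)"
    using assms by (simp add: isCont_def tendsto_discrete)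
  then show ?thesis
    unfolding eventually_at_filter by eventually_elim auto
qed

text \<open>
  Every time has a punctured neighbourhood free of discontinuities, because the path is constant on either side
  of it; so the discontinuities cannot accumulate in a compact interval.
\<close>

lemma finite_discontinuities:
  fixes s :: "real \<Rightarrow> 'a::discrete_topology"
  assumes "cadlag s"
  shows "finite {u \<in> {0<..T}. \<not> isCont s u}"
proof (rule ccontr)
  let ?S = "{u \<in> {0<..T}. \<not> isCont s u}"
  assume "infinite ?S"
  moreover have "?S \<subseteq> {0..T}" by auto
  ultimately obtain l where l: "l \<in> {0..T}" "l islimpt ?S"
    using compact_Icc[of 0 T] unfolding compact_eq_Bolzano_Weierstrass by blast
  obtain b where b: "l < b" "\<And>u. l \<le> u \<Longrightarrow> u < b \<Longrightarrow> s u = s l"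
    using cadlag_eventually_right[OF assms, of l] l by auto
  obtain a where a: "a < l" "\<And>u. a < u \<Longrightarrow> u < l \<Longrightarrow> 0 < u \<Longrightarrow> isCont s u"
  proof (cases "l = 0")
    case True
    then show thesis by (intro that[of "-1"]) auto
  next
    case False
    then obtain a k where *: "0 \<le> a" "a < l" "\<And>u. a < u \<Longrightarrow> u < l \<Longrightarrow> s u = k"
      using cadlag_eventually_left[OF assms, of l] l by (metis atLeastAtMost_iff order_less_le)
    show thesis
      by (rule that[of a]) (auto intro: * isCont_if_locally_constant[of a _ l s k])
  qed
  have "l \<in> {a<..<b}" "open {a<..<b}" using a b by auto
  with l(2) obtain u where u: "u \<in> ?S" "u \<in> {a<..<b}" "u \<noteq> l"
    by (meson islimptE)
  have "isCont s u"
  proof (cases "u < l")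
    case True
    then show ?thesis using a(2)[of u] u by auto
  next
    case False
    with u show ?thesis
      by (intro isCont_if_locally_constant[of l u b s "s l"]) (auto intro: b)
  qed
  with u show False by simp
qed

text \<open>
  The half-open interval is connected, and a continuous predicate on it is constant. Continuity at the left end
  comes from the right-continuity of the path, so a switch at that end is harmless.
\<close>

lemma constant_between_switches:
  fixes s :: "real \<Rightarrow> 'a::discrete_topology"
  assumes "cadlag s" "0 \<le> a" "a \<le> b" "\<And>u. a < u \<Longrightarrow> u < b \<Longrightarrow> isCont s u" "a \<le> t" "t < b"
  shows "s t = s a"
proof -
  have "continuous_on {a..<b} (\<lambda>u. s u = s a)"
    unfolding continuous_on_eq_continuous_within continuous_within tendsto_discrete
  proof
    fix u assume u: "u \<in> {a..<b}"
    have "eventually (\<lambda>v. s v = s u) (at u within {a..<b})"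
    proof (cases "u = a")
      case True
      obtain c where c: "a < c" "\<And>v. a \<le> v \<Longrightarrow> v < c \<Longrightarrow> s v = s a"
        using cadlag_eventually_right[OF assms(1,2)] by blast
      have "eventually (\<lambda>v. v < c) (at a within {a..<b})"
        using order_tendstoD(2)[OF tendsto_ident_at c(1)] .
      then show ?thesis
        unfolding True eventually_at_filter by eventually_elim (auto intro: c)
    next
      case False
      then have "isCont s u" using assms(4)[of u] u by auto
      then show ?thesis
        by (auto simp: eventually_at_filter elim!: eventually_mono dest!: isCont_locally_constantD)
    qed
    then show "eventually (\<lambda>v. (s v = s a) = (s u = s a)) (at u within {a..<b})"
      by eventually_elim simp
  qed
  from connected_iff_const[THEN iffD1, rule_format, OF connected_Ico this]
  obtain c where "\<forall>u\<in>{a..<b}. (s u = s a) = c"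
    by (rule exE)
  then have "(s a = s a) = c" "(s t = s a) = c"
    using assms by auto
  then show ?thesis by simp
qed

lemma eq_if_no_switch:
  fixes s :: "real \<Rightarrow> 'a::discrete_topology"
  assumes "cadlag s" "0 \<le> a" "a \<le> b" "{u \<in> {a<..b}. \<not> isCont s u} = {}"
  shows "s b = s a"
proof -
  obtain c where c: "b < c" "\<And>u. b \<le> u \<Longrightarrow> u < c \<Longrightarrow> s u = s b"
    using cadlag_eventually_right[OF assms(1), of b] assms by auto
  have "isCont s u" if "a < u" "u < c" for u
  proof (cases "u \<le> b")
    case True
    then show ?thesis using assms(4) that by auto
  next
    case False
    with that show ?thesis
      by (intro isCont_if_locally_constant[of b u c s "s b"]) (auto intro: c)
  qed
  then show ?thesis
    using constant_between_switches[of s a c b] assms c(1) by auto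
qed

text \<open>
  A single switch is visible from the two ends of the interval: had the path the same value there, it would be
  constant around the switch.
\<close>

lemma neq_if_one_switch:
  fixes s :: "real \<Rightarrow> 'a::discrete_topology"
  assumes "cadlag s" "0 \<le> a" and u: "{u \<in> {a<..b}. \<not> isCont s u} = {u}"
  shows "s b \<noteq> s a"
proof
  assume eq: "s b = s a"
  have "u \<in> {u \<in> {a<..b}. \<not> isCont s u}" using u by blast
  then have u': "a < u" "u \<le> b" "\<not> isCont s u" by auto
  have iscont: "isCont s v" if "a < v" "v \<le> b" "v \<noteq> u" for v
  proof (rule ccontr)
    assume "\<not> isCont s v"
    with that have "v \<in> {u \<in> {a<..b}. \<not> isCont s u}" by simp
    with that show False unfolding u by simp
  qed
  have bu: "s b = s u"
    using u' assms(1,2) iscont by (intro eq_if_no_switch) auto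
  have left: "s v = s a" if "a \<le> v" "v < u" for v
    using constant_between_switches[of s a u v] that assms(1,2) u' iscont by auto
  obtain c where c: "u < c" "\<And>v. u \<le> v \<Longrightarrow> v < c \<Longrightarrow> s v = s u"
    using cadlag_eventually_right[OF assms(1), of u] assms(1,2) u' by auto
  have "s v = s a" if "a < v" "v < c" for v
  proof (cases "v < u")
    case True
    with that show ?thesis by (intro left) auto
  next
    case False
    with that have "s v = s u" by (intro c) auto
    then show ?thesis using bu eq by simp
  qed
  then have "isCont s u"
    using isCont_if_locally_constant[of a u c s "s a"] u' c(1) by blast
  with u' show False by simp
qed

lemma num_switches_mono:
  assumes "cadlag s" "t \<le> t'"
  shows "num_switches s t \<le> num_switches s t'"
  unfolding num_switches_def
  using assms(2) by (intro card_mono finite_discontinuities[OF assms(1)]) auto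

lemma AE_no_switch:
  fixes s :: "real \<Rightarrow> 'a::discrete_topology"
  assumes "cadlag s"
  shows "AE t in lborel. 0 < t \<longrightarrow> isCont s t"
proof -
  have "countable (\<Union>n::nat. {u \<in> {0<..real n}. \<not> isCont s u})"
    using finite_discontinuities[OF assms] by (intro countable_UN) (auto intro: countable_finite)
  moreover have "{u. 0 < u \<and> \<not> isCont s u} \<subseteq> (\<Union>n::nat. {u \<in> {0<..real n}. \<not> isCont s u})"
    using real_arch_simple by auto
  ultimately have "countable {u. 0 < u \<and> \<not> isCont s u}"
    by (rule countable_subset[rotated])
  then have "{u. 0 < u \<and> \<not> isCont s u} \<in> null_sets lborel"
    by (rule countable_imp_null_set_lborel)
  then show ?thesis by (rule AE_I') auto
qed

section \<open>Absolutely continuous functions\<close>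

lemma sum_interval_lengths_le_measure:
  fixes D :: "real set set"
  assumes D: "D division_of \<Union>D" and U: "\<Union>D \<subseteq> U" "U \<in> lmeasurable"
  shows "(\<Sum>k\<in>D. Sup k - Inf k) \<le> measure lebesgue U"
proof -
  have len: "k \<in> lmeasurable \<and> measure lebesgue k = Sup k - Inf k \<and> convex k" if kD: "k \<in> D" for k
  proof -
    obtain c d where "k = {c..d}" "k \<noteq> {}"
      using division_ofD(3)[OF D kD] division_ofD(4)[OF D kD] by (metis box_real(2))
    then show ?thesis by auto
  qed
  have "(\<Sum>k\<in>D. Sup k - Inf k) = (\<Sum>k\<in>D. measure lebesgue k)"
    using len by (intro sum.cong) auto
  also have "\<dots> = measure lebesgue (\<Union>D)"
  proof (rule measure_negligible_finite_Union[symmetric])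
    show "pairwise (\<lambda>S T. negligible (S \<inter> T)) D"
    proof (rule pairwiseI)
      fix k l assume kl: "k \<in> D" "l \<in> D" "k \<noteq> l"
      have "convex (k \<inter> l)" using len kl by (intro convex_Int) auto
      moreover have "interior (k \<inter> l) = {}"
        using division_ofD(5)[OF D kl] by simp
      ultimately show "negligible (k \<inter> l)"
        by (simp add: negligible_convex_interior)
    qed
  qed (use len D division_ofD(1) in auto)
  also have "\<dots> \<le> measure lebesgue U"
    using U len D by (intro measure_mono_fmeasurable fmeasurableD fmeasurable.finite_Union) auto
  finally show ?thesis .
qed

lemma null_set_outer_open:
  fixes N :: "'a::euclidean_space set"
  assumes "N \<in> null_sets lborel" "\<delta> > 0"
  obtains U where "open U" "N \<subseteq> U" "U \<in> lmeasurable" "measure lebesgue U < \<delta>"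
proof -
  have N: "N \<in> null_sets lebesgue" using assms(1) by (rule null_sets_completionI)
  then obtain U where U: "open U" "N \<subseteq> U" "U - N \<in> lmeasurable" "emeasure lebesgue (U - N) < ennreal \<delta>"
    using sets_lebesgue_outer_open[OF _ assms(2), of N] by blast
  have "U \<in> lmeasurable" "measure lebesgue (U - N) = measure lebesgue U"
    using U N by (auto simp: measure_Diff_null_set fmeasurable_def emeasure_Diff_null_set)
  moreover have "measure lebesgue (U - N) < \<delta>"
    using U(3,4) assms(2) by (simp add: emeasure_eq_measure2 ennreal_less_iff)
  ultimately show thesis using U that by auto
qed

text \<open>
  The exceptional null set is covered by an open set of small measure. At the other points, differentiability
  provides a gauge that bounds the increments over small intervals around them. In a tagged division that is
  fine for both, the increments over intervals with good tags add up to at most the slope bound times the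
  length, up to an error, and those over intervals with exceptional tags are small by absolute continuity.
\<close>

lemma absolutely_continuous_mean_value_inequality:
  fixes w :: "real \<Rightarrow> 'a::real_normed_vector"
  assumes ac: "absolutely_continuous_on_interval a b w" and "a \<le> b" "0 \<le> B"
    and deriv: "AE t in lborel. a < t \<and> t < b \<longrightarrow> (\<exists>d. (w has_vector_derivative d) (at t) \<and> norm d \<le> B)"
  shows "norm (w b - w a) \<le> B * (b - a)"
proof (rule field_le_epsilon)
  fix e :: real assume "e > 0"
  define \<epsilon> where "\<epsilon> = e / (b - a + 1)"
  have \<epsilon>: "\<epsilon> > 0" "\<epsilon> * (b - a + 1) = e"
    using \<open>e > 0\<close> \<open>a \<le> b\<close> unfolding \<epsilon>_def by auto
  let ?\<Delta> = "\<lambda>K. norm (w (Sup K) - w (Inf K))"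
  obtain \<delta> where \<delta>: "\<delta> > 0"
    "\<And>D. D division_of \<Union>D \<Longrightarrow> \<Union>D \<subseteq> {a..b} \<Longrightarrow> (\<Sum>k\<in>D. Sup k - Inf k) < \<delta> \<Longrightarrow> (\<Sum>k\<in>D. ?\<Delta> k) < \<epsilon>"
    using ac \<open>\<epsilon> > 0\<close> unfolding absolutely_continuous_on_interval_def by meson
  obtain N0 where N0: "N0 \<in> null_sets lborel"
    "{t. \<not> (a < t \<and> t < b \<longrightarrow> (\<exists>d. (w has_vector_derivative d) (at t) \<and> norm d \<le> B))} \<subseteq> N0"
    using deriv by (auto simp: eventually_ae_filter)
  \<comment> \<open>The endpoints are put among the bad tags, as nothing is known about the derivative there.\<close>
  define E where "E = N0 \<union> {a, b}"
  have "{a, b} \<in> null_sets lborel"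
    by (intro finite_imp_null_set_lborel) simp
  then have "E \<in> null_sets lborel" unfolding E_def using N0(1) by (rule null_sets.Un[rotated])
  then obtain U where U: "open U" "E \<subseteq> U" "U \<in> lmeasurable" "measure lebesgue U < \<delta>"
    using null_set_outer_open \<delta>(1) by blast
  have "\<exists>r>0. \<forall>c d. c \<le> t \<and> t \<le> d \<and> {c..d} \<subseteq> ball t r \<longrightarrow> norm (w d - w c) \<le> (B + \<epsilon>) * (d - c)"
    if t: "t \<in> {a..b} - E" for t
  proof -
    have "t \<notin> N0" "a < t" "t < b" using t by (auto simp: E_def)
    then obtain v where v: "(w has_vector_derivative v) (at t)" "norm v \<le> B"
      using N0(2) by blast
    then obtain r where r: "r > 0"
      "\<And>y. norm (y - t) < r \<Longrightarrow> norm (w y - w t - (y - t) *\<^sub>R v) \<le> \<epsilon> * norm (y - t)"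
      using \<open>\<epsilon> > 0\<close> unfolding has_vector_derivative_def has_derivative_at_alt by meson
    show ?thesis
    proof (intro exI[of _ r] conjI allI impI)
      fix c d assume cd: "c \<le> t \<and> t \<le> d \<and> {c..d} \<subseteq> ball t r"
      then have "c \<in> {c..d}" "d \<in> {c..d}" by auto
      with cd have "c \<in> ball t r" "d \<in> ball t r" by blast+
      then have near: "norm (c - t) < r" "norm (d - t) < r" by (auto simp: dist_norm norm_minus_commute)
      have "w d - w c = (w d - w t - (d - t) *\<^sub>R v) - (w c - w t - (c - t) *\<^sub>R v) + (d - c) *\<^sub>R v"
        by (simp add: algebra_simps)
      also have "norm \<dots> \<le> norm (w d - w t - (d - t) *\<^sub>R v) + norm (w c - w t - (c - t) *\<^sub>R v) + norm ((d - c) *\<^sub>R v)"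
        by (meson norm_triangle_ineq norm_triangle_ineq4 add_right_mono order_trans)
      also have "\<dots> \<le> \<epsilon> * norm (d - t) + \<epsilon> * norm (c - t) + (d - c) * B"
        using r(2)[OF near(1)] r(2)[OF near(2)] v(2) cd by (intro add_mono) (auto intro!: mult_left_mono)
      also have "\<dots> = (B + \<epsilon>) * (d - c)"
        using cd by (simp add: algebra_simps)
      finally show "norm (w d - w c) \<le> (B + \<epsilon>) * (d - c)" .
    qed (rule r(1))
  qed
  then obtain r where r: "\<And>t. t \<in> {a..b} - E \<Longrightarrow> r t > 0"
    "\<And>t c d. t \<in> {a..b} - E \<Longrightarrow> c \<le> t \<Longrightarrow> t \<le> d \<Longrightarrow> {c..d} \<subseteq> ball t (r t) \<Longrightarrow> norm (w d - w c) \<le> (B + \<epsilon>) * (d - c)"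
    by metis
  define \<gamma> where "\<gamma> t = (if t \<in> E then U else ball t (if t \<in> {a..b} then r t else 1))" for t
  have "gauge \<gamma>"
    using U r(1) unfolding gauge_def \<gamma>_def by auto
  then obtain p where p: "p tagged_division_of {a..b}" "\<gamma> fine p"
    by (rule fine_division_exists_real)
  have pK: "\<exists>c d. K = {c..d} \<and> c \<le> x \<and> x \<le> d \<and> K \<subseteq> \<gamma> x \<and> x \<in> {a..b} \<and> Inf K = c \<and> Sup K = d"
    if xK: "(x, K) \<in> p" for x K
  proof -
    obtain c d where "K = {c..d}" using tagged_division_ofD(4)[OF p(1) xK] by auto
    moreover have "x \<in> K" "K \<subseteq> {a..b}" using tagged_division_ofD(2,3)[OF p(1) xK] by auto
    moreover have "K \<subseteq> \<gamma> x" using p(2) xK by (auto simp: fine_def)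
    ultimately show ?thesis by auto
  qed
  have "finite p" using p(1) by (rule tagged_division_of_finite)
  define q where "q = {(x, K) \<in> p. x \<in> E}"
  have "q \<subseteq> p" by (auto simp: q_def)
  have bad: "(\<Sum>(x, K)\<in>q. ?\<Delta> K) < \<epsilon>"
  proof -
    have part: "q tagged_partial_division_of {a..b}"
      using p(1) \<open>q \<subseteq> p\<close> tagged_partial_division_subset unfolding tagged_division_of_def by blast
    then have q: "q tagged_division_of \<Union>(snd ` q)"
      by (rule tagged_partial_division_of_Union_self)
    \<comment> \<open>Sup and Inf of the empty set are junk, so it is set apart before two tags of the same
      interval are identified.\<close>
    let ?\<Delta>' = "\<lambda>K. if K = {} then 0 else ?\<Delta> K"
    have "(\<Sum>(x, K)\<in>q. ?\<Delta> K) = (\<Sum>(x, K)\<in>q. ?\<Delta>' K)"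
      using pK \<open>q \<subseteq> p\<close> by (intro sum.cong) fastforce+
    also have "\<dots> = (\<Sum>K\<in>snd ` q. ?\<Delta>' K)"
      by (rule sum.over_tagged_division_lemma[OF q]) (auto simp: le_less)
    also have "\<dots> = (\<Sum>K\<in>snd ` q. ?\<Delta> K)"
      using pK \<open>q \<subseteq> p\<close> by (intro sum.cong) fastforce+
    also have "\<dots> < \<epsilon>"
    proof (rule \<delta>(2))
      show D: "snd ` q division_of \<Union>(snd ` q)"
        by (rule division_of_tagged_division[OF q])
      show "\<Union>(snd ` q) \<subseteq> {a..b}"
        using tagged_division_ofD(3)[OF p(1)] \<open>q \<subseteq> p\<close> by fastforce
      have "\<Union>(snd ` q) \<subseteq> U"
        using pK unfolding q_def \<gamma>_def by fastforce
      then show "(\<Sum>k\<in>snd ` q. Sup k - Inf k) < \<delta>"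
        using sum_interval_lengths_le_measure[OF D _ U(3)] U(4) by linarith
    qed
    finally show ?thesis .
  qed
  have good: "(\<Sum>(x, K)\<in>p - q. ?\<Delta> K) \<le> (B + \<epsilon>) * (b - a)"
  proof -
    have "(\<Sum>(x, K)\<in>p - q. ?\<Delta> K) \<le> (\<Sum>(x, K)\<in>p - q. (B + \<epsilon>) * (Sup K - Inf K))"
    proof (rule sum_mono, clarify)
      fix x K assume xK: "(x, K) \<in> p" "(x, K) \<notin> q"
      then obtain c d where "K = {c..d}" "c \<le> x" "x \<le> d" "K \<subseteq> \<gamma> x" "x \<in> {a..b}" "Inf K = c" "Sup K = d"
        using pK by blast
      then show "?\<Delta> K \<le> (B + \<epsilon>) * (Sup K - Inf K)"
        using r(2)[of x c d] xK by (auto simp: q_def \<gamma>_def split: if_splits)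
    qed
    also have "\<dots> \<le> (\<Sum>(x, K)\<in>p. (B + \<epsilon>) * (Sup K - Inf K))"
      using \<open>finite p\<close> pK \<open>0 \<le> B\<close> \<epsilon>(1) by (intro sum_mono2) (fastforce intro!: mult_nonneg_nonneg)+
    also have "\<dots> = (B + \<epsilon>) * (\<Sum>(x, K)\<in>p. Sup K - Inf K)"
      by (simp add: sum_distrib_left case_prod_beta)
    also have "(\<Sum>(x, K)\<in>p. Sup K - Inf K) = b - a"
      using additive_tagged_division_1[OF \<open>a \<le> b\<close> p(1), of "\<lambda>x. x"] .
    finally show ?thesis .
  qed
  have "w b - w a = (\<Sum>(x, K)\<in>p. w (Sup K) - w (Inf K))"
    using additive_tagged_division_1[OF \<open>a \<le> b\<close> p(1), of w] by simp
  also have "norm \<dots> \<le> (\<Sum>(x, K)\<in>p. ?\<Delta> K)"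
    by (rule order_trans[OF norm_sum]) (simp add: case_prod_beta)
  also have "\<dots> = (\<Sum>(x, K)\<in>p - q. ?\<Delta> K) + (\<Sum>(x, K)\<in>q. ?\<Delta> K)"
    using \<open>finite p\<close> \<open>q \<subseteq> p\<close> by (rule sum.subset_diff[rotated])
  also have "\<dots> \<le> (B + \<epsilon>) * (b - a) + \<epsilon>"
    using good bad by simp
  also have "\<dots> = B * (b - a) + e"
    using \<epsilon>(2) by (simp add: algebra_simps)
  finally show "norm (w b - w a) \<le> B * (b - a) + e" .
qed

lemma absolutely_continuous_subinterval:
  assumes "absolutely_continuous_on_interval a b w" "a \<le> c" "d \<le> b"
  shows "absolutely_continuous_on_interval c d w"
proof -
  have "{c..d} \<subseteq> {a..b}" using assms(2,3) by auto
  with assms(1) show ?thesis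
    unfolding absolutely_continuous_on_interval_def by (meson order_trans)
qed

lemma absolutely_continuous_diff:
  assumes "absolutely_continuous_on_interval a b v" "absolutely_continuous_on_interval a b w"
  shows "absolutely_continuous_on_interval a b (\<lambda>t. v t - w t)"
  unfolding absolutely_continuous_on_interval_def
proof (intro allI impI)
  fix \<epsilon> :: real assume "\<epsilon> > 0"
  then have "\<epsilon> / 2 > 0" by simp
  obtain \<delta>1 where \<delta>1: "\<delta>1 > 0"
    "\<And>D. D division_of \<Union>D \<and> \<Union>D \<subseteq> {a..b} \<and> (\<Sum>k\<in>D. Sup k - Inf k) < \<delta>1 \<Longrightarrow> (\<Sum>k\<in>D. norm (v (Sup k) - v (Inf k))) < \<epsilon> / 2"
    using assms(1) \<open>\<epsilon> / 2 > 0\<close> unfolding absolutely_continuous_on_interval_def by meson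
  obtain \<delta>2 where \<delta>2: "\<delta>2 > 0"
    "\<And>D. D division_of \<Union>D \<and> \<Union>D \<subseteq> {a..b} \<and> (\<Sum>k\<in>D. Sup k - Inf k) < \<delta>2 \<Longrightarrow> (\<Sum>k\<in>D. norm (w (Sup k) - w (Inf k))) < \<epsilon> / 2"
    using assms(2) \<open>\<epsilon> / 2 > 0\<close> unfolding absolutely_continuous_on_interval_def by meson
  show "\<exists>\<delta>>0. \<forall>D. D division_of \<Union>D \<and> \<Union>D \<subseteq> {a..b} \<and> (\<Sum>k\<in>D. Sup k - Inf k) < \<delta>
    \<longrightarrow> (\<Sum>k\<in>D. norm (v (Sup k) - w (Sup k) - (v (Inf k) - w (Inf k)))) < \<epsilon>"
  proof (intro exI[of _ "min \<delta>1 \<delta>2"] conjI allI impI)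
    fix D :: "real set set"
    assume D: "D division_of \<Union>D \<and> \<Union>D \<subseteq> {a..b} \<and> (\<Sum>k\<in>D. Sup k - Inf k) < min \<delta>1 \<delta>2"
    have "(\<Sum>k\<in>D. norm (v (Sup k) - w (Sup k) - (v (Inf k) - w (Inf k))))
        \<le> (\<Sum>k\<in>D. norm (v (Sup k) - v (Inf k)) + norm (w (Sup k) - w (Inf k)))"
    proof (rule sum_mono)
      fix k
      show "norm (v (Sup k) - w (Sup k) - (v (Inf k) - w (Inf k)))
          \<le> norm (v (Sup k) - v (Inf k)) + norm (w (Sup k) - w (Inf k))"
        using norm_triangle_ineq4[of "v (Sup k) - v (Inf k)" "w (Sup k) - w (Inf k)"]
        by (simp add: algebra_simps)
    qed
    also have "\<dots> < \<epsilon>"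
      using \<delta>1(2)[of D] \<delta>2(2)[of D] D by (simp add: sum.distrib)
    finally show "(\<Sum>k\<in>D. norm (v (Sup k) - w (Sup k) - (v (Inf k) - w (Inf k)))) < \<epsilon>" .
  qed (use \<delta>1 \<delta>2 in auto)
qed

lemma absolutely_continuous_imp_continuous_on:
  fixes w :: "real \<Rightarrow> 'a::real_normed_vector"
  assumes "absolutely_continuous_on_interval a b w"
  shows "continuous_on {a..b} w"
  unfolding continuous_on_iff
proof (intro ballI allI impI)
  fix x e :: real assume x: "x \<in> {a..b}" and "e > 0"
  then obtain \<delta> where \<delta>: "\<delta> > 0"
    "\<And>D. D division_of \<Union>D \<and> \<Union>D \<subseteq> {a..b} \<and> (\<Sum>k\<in>D. Sup k - Inf k) < \<delta> \<Longrightarrow> (\<Sum>k\<in>D. norm (w (Sup k) - w (Inf k))) < e"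
    using assms unfolding absolutely_continuous_on_interval_def by meson
  have close: "norm (w v - w u) < e" if uv: "u \<le> v" "{u..v} \<subseteq> {a..b}" "v - u < \<delta>" for u v
    using \<delta>(2)[of "{{u..v}}"] uv division_of_self[of u v] by simp
  show "\<exists>d>0. \<forall>x'\<in>{a..b}. dist x' x < d \<longrightarrow> dist (w x') (w x) < e"
  proof (intro exI[of _ \<delta>] conjI ballI impI)
    fix y assume y: "y \<in> {a..b}" "dist y x < \<delta>"
    then show "dist (w y) (w x) < e"
      using close[of x y] close[of y x] x
      by (cases "x \<le> y") (auto simp: dist_norm norm_minus_commute)
  qed (rule \<delta>(1))
qed

lemma lipschitz_imp_absolutely_continuous:
  fixes w :: "real \<Rightarrow> 'a::real_normed_vector"
  assumes "\<And>u v. a \<le> u \<Longrightarrow> u \<le> v \<Longrightarrow> v \<le> b \<Longrightarrow> norm (w v - w u) \<le> B * (v - u)"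
  shows "absolutely_continuous_on_interval a b w"
  unfolding absolutely_continuous_on_interval_def
proof (intro allI impI)
  fix \<epsilon> :: real assume "\<epsilon> > 0"
  show "\<exists>\<delta>>0. \<forall>D. D division_of \<Union>D \<and> \<Union>D \<subseteq> {a..b} \<and> (\<Sum>k\<in>D. Sup k - Inf k) < \<delta>
    \<longrightarrow> (\<Sum>k\<in>D. norm (w (Sup k) - w (Inf k))) < \<epsilon>"
  proof (intro exI[of _ "\<epsilon> / (\<bar>B\<bar> + 1)"] conjI allI impI)
    fix D :: "real set set"
    assume D: "D division_of \<Union>D \<and> \<Union>D \<subseteq> {a..b} \<and> (\<Sum>k\<in>D. Sup k - Inf k) < \<epsilon> / (\<bar>B\<bar> + 1)"
    have "(\<Sum>k\<in>D. norm (w (Sup k) - w (Inf k))) \<le> (\<Sum>k\<in>D. (\<bar>B\<bar> + 1) * (Sup k - Inf k))"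
    proof (rule sum_mono)
      fix k assume "k \<in> D"
      then obtain c d where k: "k = {c..d}" "k \<noteq> {}" "k \<subseteq> {a..b}"
        using D division_ofD(3,4)[of D "\<Union>D"] by (metis Sup_upper box_real(2) order_trans)
      then have "norm (w d - w c) \<le> B * (d - c)" using assms by auto
      also have "\<dots> \<le> (\<bar>B\<bar> + 1) * (d - c)" using k by (intro mult_right_mono) auto
      finally show "norm (w (Sup k) - w (Inf k)) \<le> (\<bar>B\<bar> + 1) * (Sup k - Inf k)"
        using k by simp
    qed
    also have "\<dots> = (\<bar>B\<bar> + 1) * (\<Sum>k\<in>D. Sup k - Inf k)"
      by (simp add: sum_distrib_left)
    also have "\<dots> < \<epsilon>"
      using D by (simp add: pos_less_divide_eq mult.commute)
    finally show "(\<Sum>k\<in>D. norm (w (Sup k) - w (Inf k))) < \<epsilon>" .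
  qed (use \<open>\<epsilon> > 0\<close> in auto)
qed

lemma absolutely_continuous_cong:
  assumes v: "absolutely_continuous_on_interval a b v" and eq: "\<And>t. t \<in> {a..b} \<Longrightarrow> w t = v t"
  shows "absolutely_continuous_on_interval a b w"
proof -
  have sum_eq: "(\<Sum>k\<in>D. norm (w (Sup k) - w (Inf k))) = (\<Sum>k\<in>D. norm (v (Sup k) - v (Inf k)))"
    if D: "D division_of \<Union>D" "\<Union>D \<subseteq> {a..b}" for D
  proof (rule sum.cong)
    fix k assume "k \<in> D"
    then obtain c d where "k = {c..d}" "k \<noteq> {}" "k \<subseteq> {a..b}"
      using division_ofD(3)[OF D(1)] division_ofD(4)[OF D(1)] D by (metis Sup_upper box_real(2) order_trans)
    then have "w (Sup k) = v (Sup k)" "w (Inf k) = v (Inf k)"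
      by (auto intro!: eq)
    then show "norm (w (Sup k) - w (Inf k)) = norm (v (Sup k) - v (Inf k))" by simp
  qed simp
  show ?thesis
    unfolding absolutely_continuous_on_interval_def
  proof (intro allI impI)
    fix \<epsilon> :: real assume "\<epsilon> > 0"
    with v obtain \<delta> where \<delta>: "\<delta> > 0"
      "\<And>D. D division_of \<Union>D \<and> \<Union>D \<subseteq> {a..b} \<and> (\<Sum>k\<in>D. Sup k - Inf k) < \<delta> \<Longrightarrow> (\<Sum>k\<in>D. norm (v (Sup k) - v (Inf k))) < \<epsilon>"
      unfolding absolutely_continuous_on_interval_def by meson
    show "\<exists>\<delta>>0. \<forall>D. D division_of \<Union>D \<and> \<Union>D \<subseteq> {a..b} \<and> (\<Sum>k\<in>D. Sup k - Inf k) < \<delta>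
      \<longrightarrow> (\<Sum>k\<in>D. norm (w (Sup k) - w (Inf k))) < \<epsilon>"
      using \<delta> sum_eq by (intro exI[of _ \<delta>] conjI allI impI) simp_all
  qed
qed

section \<open>Uniqueness of trajectories\<close>

lemma locally_lipschitz_imp_lipschitz_on_compact:
  assumes "locally_lipschitz g" "compact X"
  obtains L where "L-lipschitz_on X g"
proof -
  have loc: "local_lipschitz {0 :: real} X (\<lambda>_. g)"
    using assms(1) unfolding locally_lipschitz_def by (rule local_lipschitz_subset) auto
  obtain L where "\<And>t. t \<in> {0 :: real} \<Longrightarrow> L-lipschitz_on X g"
    by (rule local_lipschitz_compact_implies_lipschitz[OF loc assms(2)]) auto
  then show thesis using that by simp
qed

lemma uniformly_lipschitz_on_compact:
  assumes "finite P" "\<And>p. p \<in> P \<Longrightarrow> locally_lipschitz (f p)" "compact X"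
  obtains L where "0 \<le> L" "\<And>p. p \<in> P \<Longrightarrow> L-lipschitz_on X (f p)"
proof -
  have "\<exists>L. \<forall>p\<in>P. (L p)-lipschitz_on X (f p)"
    using assms(2,3) by (intro bchoice) (meson locally_lipschitz_imp_lipschitz_on_compact)
  then obtain L where L: "\<And>p. p \<in> P \<Longrightarrow> (L p)-lipschitz_on X (f p)" by blast
  show thesis
  proof (rule that)
    show "0 \<le> (\<Sum>p\<in>P. \<bar>L p\<bar>)" by (intro sum_nonneg) auto
    show "(\<Sum>p\<in>P. \<bar>L p\<bar>)-lipschitz_on X (f p)" if "p \<in> P" for p
    proof (rule lipschitz_on_le[OF L[OF that]])
      have "L p \<le> \<bar>L p\<bar>" by simp
      also have "\<dots> \<le> (\<Sum>p\<in>P. \<bar>L p\<bar>)"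
        using that assms(1) by (intro member_le_sum) auto
      finally show "L p \<le> (\<Sum>p\<in>P. \<bar>L p\<bar>)" .
    qed
  qed
qed

text \<open>
  On a step of length \<open>1 / (2 * (L + 1))\<close> that starts at a zero of \<open>w\<close>, the mean value
  inequality bounds the maximum of the norm by half of itself; finitely many such steps reach any time.
\<close>

lemma gronwall_zero:
  fixes w :: "real \<Rightarrow> 'a::real_normed_vector"
  assumes ac: "absolutely_continuous_on_interval 0 T w" and "w 0 = 0" "0 \<le> L"
    and deriv: "AE t in lborel. 0 < t \<and> t < T \<longrightarrow>
      (\<exists>d. (w has_vector_derivative d) (at t) \<and> norm d \<le> L * norm (w t))"
    and t: "t \<in> {0..T}"
  shows "w t = 0"
proof -
  \<comment> \<open>Adding \<open>1\<close> to \<open>L\<close> keeps the step finite when \<open>L = 0\<close>.\<close>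
  define h where "h = 1 / (2 * (L + 1))"
  have h: "h > 0" "L * h \<le> 1 / 2" using \<open>0 \<le> L\<close> by (auto simp: h_def field_simps)
  have "\<forall>t\<in>{0..T}. t \<le> real n * h \<longrightarrow> w t = 0" for n
  proof (induction n)
    case 0
    then show ?case using \<open>w 0 = 0\<close> by auto
  next
    case (Suc n)
    show ?case
    proof (intro ballI impI)
      fix t assume t: "t \<in> {0..T}" "t \<le> real (Suc n) * h"
      show "w t = 0"
      proof (cases "t \<le> real n * h")
        case True
        then show ?thesis using Suc t by auto
      next
        case False
        define a where "a = real n * h"
        have a: "0 \<le> a" "a < t" "t \<le> a + h" and "w a = 0"
          using False h t Suc.IH by (auto simp: a_def algebra_simps)
        have "continuous_on {a..t} (\<lambda>u. norm (w u))"
          using absolutely_continuous_imp_continuous_on[OF ac] a t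
          by (intro continuous_on_norm) (auto elim!: continuous_on_subset)
        then obtain u where u: "u \<in> {a..t}" "\<And>v. v \<in> {a..t} \<Longrightarrow> norm (w v) \<le> norm (w u)"
          using continuous_attains_sup[of "{a..t}" "\<lambda>u. norm (w u)"] a by auto
        have "norm (w u - w a) \<le> L * norm (w u) * (u - a)"
        proof (rule absolutely_continuous_mean_value_inequality)
          show "absolutely_continuous_on_interval a u w"
            using ac by (rule absolutely_continuous_subinterval) (use u a t in auto)
          show "AE v in lborel. a < v \<and> v < u \<longrightarrow>
              (\<exists>d. (w has_vector_derivative d) (at v) \<and> norm d \<le> L * norm (w u))"
            using deriv
          proof eventually_elim
            case (elim v)
            show ?case
            proof
              assume v: "a < v \<and> v < u"
              then obtain d where d: "(w has_vector_derivative d) (at v)" "norm d \<le> L * norm (w v)"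
                using elim u a t by auto
              moreover have "L * norm (w v) \<le> L * norm (w u)"
                using \<open>0 \<le> L\<close> u v by (intro mult_left_mono) auto
              ultimately show "\<exists>d. (w has_vector_derivative d) (at v) \<and> norm d \<le> L * norm (w u)"
                by fastforce
            qed
          qed
        qed (use u \<open>0 \<le> L\<close> in auto)
        also have "\<dots> \<le> L * norm (w u) * h"
          using u a \<open>0 \<le> L\<close> by (intro mult_left_mono) auto
        also have "\<dots> \<le> 1 / 2 * norm (w u)"
          using h(2) mult_right_mono[OF h(2), of "norm (w u)"] by (simp add: mult_ac)
        finally have "norm (w u) \<le> 1 / 2 * norm (w u)" using \<open>w a = 0\<close> by simp
        then have "norm (w u) = 0" using norm_ge_zero[of "w u"] by linarith
        then show ?thesis using u(2)[of t] a by auto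
      qed
    qed
  qed
  moreover obtain n :: nat where "t / h \<le> real n" using real_arch_simple by blast
  then have "t \<le> real n * h" using h(1) by (simp add: pos_divide_le_eq)
  ultimately show ?thesis using t by blast
qed

text \<open>
  Both solutions stay in a compact set, on which the finitely many fields share a Lipschitz constant; so their
  difference satisfies the hypothesis of \<open>gronwall_zero\<close>.
\<close>

lemma switched_solution_unique_on_interval:
  fixes x y :: "real \<Rightarrow> real ^ 'n"
  assumes P: "finite P" "\<And>p. p \<in> P \<Longrightarrow> locally_lipschitz (f p)" "\<And>t. 0 \<le> t \<Longrightarrow> s t \<in> P"
    and x: "absolutely_continuous_on_interval 0 T x"
      "AE t in lborel. 0 < t \<and> t < T \<longrightarrow> (x has_vector_derivative f (s t) (x t)) (at t)"
    and y: "absolutely_continuous_on_interval 0 T y"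
      "AE t in lborel. 0 < t \<and> t < T \<longrightarrow> (y has_vector_derivative f (s t) (y t)) (at t)"
    and "x 0 = y 0" "t \<in> {0..T}"
  shows "x t = y t"
proof -
  define X where "X = x ` {0..T} \<union> y ` {0..T}"
  have "compact X"
    unfolding X_def using x(1) y(1)
    by (intro compact_Un compact_continuous_image absolutely_continuous_imp_continuous_on) auto
  then obtain L where L: "0 \<le> L" "\<And>p. p \<in> P \<Longrightarrow> L-lipschitz_on X (f p)"
    using uniformly_lipschitz_on_compact[of P f X] P(1,2) by blast
  have "x t - y t = 0"
  proof (rule gronwall_zero[where w = "\<lambda>t. x t - y t" and T = T and L = L])
    show "AE t in lborel. 0 < t \<and> t < T \<longrightarrow> (\<exists>d. ((\<lambda>t. x t - y t) has_vector_derivative d) (at t)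
        \<and> norm d \<le> L * norm (x t - y t))"
      using x(2) y(2)
    proof eventually_elim
      case (elim t)
      show ?case
      proof
        assume t: "0 < t \<and> t < T"
        then have "((\<lambda>t. x t - y t) has_vector_derivative (f (s t) (x t) - f (s t) (y t))) (at t)"
          using elim by (intro has_vector_derivative_diff) auto
        moreover have "norm (f (s t) (x t) - f (s t) (y t)) \<le> L * norm (x t - y t)"
          using L(2)[OF P(3)[of t]] t unfolding lipschitz_on_def X_def dist_norm by auto
        ultimately show "\<exists>d. ((\<lambda>t. x t - y t) has_vector_derivative d) (at t)
            \<and> norm d \<le> L * norm (x t - y t)" by blast
      qed
    qed
  qed (use assms L absolutely_continuous_diff in auto)
  then show ?thesis by simp
qed

section \<open>Trajectories of cut-off vector fields\<close>

lemma indefinite_integral_lipschitz: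
  fixes h :: "real \<Rightarrow> 'a::banach"
  assumes "h integrable_on {c..b}" "\<And>s. c \<le> s \<Longrightarrow> s \<le> b \<Longrightarrow> norm (h s) \<le> B" "c \<le> a" "a \<le> b"
  shows "norm (integral {c..b} h - integral {c..a} h) \<le> B * (b - a)"
proof -
  have "integral {c..a} h + integral {a..b} h = integral {c..b} h"
    using assms by (intro Henstock_Kurzweil_Integration.integral_combine) auto
  then have "norm (integral {c..b} h - integral {c..a} h) = norm (integral {a..b} h)"
    by (metis add_diff_cancel_left')
  also have "\<dots> \<le> B * (b - a)"
  proof -
    have "h integrable_on {a..b}"
      using assms(1) by (rule integrable_on_subinterval) (use assms in auto)
    then have "norm (integral {a..b} h) \<le> integral {a..b} (\<lambda>_. B)"
      using assms by (intro integral_norm_bound_integral) auto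
    then show ?thesis using assms by (simp add: mult.commute)
  qed
  finally show ?thesis .
qed

lemma integral_exp_linear_le:
  fixes c t :: real
  assumes "c > 0" "t \<ge> 0"
  shows "integral {0..t} (\<lambda>s. exp (c * s)) \<le> exp (c * t) / c"
proof -
  have "((\<lambda>s. exp (c * s)) has_integral (exp (c * t) / c - exp (c * 0) / c)) {0..t}"
  proof (rule fundamental_theorem_of_calculus[OF assms(2)])
    fix x
    have "((\<lambda>s. exp (c * s) / c) has_real_derivative exp (c * x)) (at x within {0..t})"
      using assms(1) by (auto intro!: derivative_eq_intros)
    then show "((\<lambda>s. exp (c * s) / c) has_vector_derivative exp (c * x)) (at x within {0..t})"
      by (simp add: has_real_derivative_iff_has_vector_derivative)
  qed
  then have "integral {0..t} (\<lambda>s. exp (c * s)) = exp (c * t) / c - exp (c * 0) / c"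
    by (rule integral_unique)
  then show ?thesis using assms by simp
qed

text \<open>
  The unknown is \<open>u t = exp (- c * t) *\<^sub>R (z t - x0)\<close>. With this exponential weight the
  integral operator maps the bounded continuous functions on the whole time axis to themselves and, for
  \<open>c = 2 * L + 1\<close>, is a contraction; so one application of the fixed point theorem gives the
  solution for all times.
\<close>

lemma picard_global_solution:
  fixes G :: "real \<Rightarrow> 'a::banach \<Rightarrow> 'a"
  assumes "0 \<le> L" and lip: "\<And>t x y. 0 \<le> t \<Longrightarrow> norm (G t x - G t y) \<le> L * norm (x - y)"
    and bound: "\<And>t x. 0 \<le> t \<Longrightarrow> norm (G t x) \<le> B"
    and int: "\<And>x t. continuous_on UNIV x \<Longrightarrow> 0 \<le> t \<Longrightarrow> (\<lambda>s. G s (x s)) integrable_on {0..t}"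
  obtains z where "continuous_on UNIV z" "\<And>t. 0 \<le> t \<Longrightarrow> z t = x0 + integral {0..t} (\<lambda>s. G s (z s))"
proof -
  define c where "c = 2 * L + 1"
  have c: "c \<ge> 1" "L / c \<le> 1 / 2" using \<open>0 \<le> L\<close> by (auto simp: c_def field_simps)
  have "0 \<le> B" using bound[of 0 undefined] norm_ge_zero order_trans by blast
  \<comment> \<open>The candidate solution that belongs to a weighted unknown \<open>u\<close>.\<close>
  define Y where "Y u s = x0 + exp (c * s) *\<^sub>R apply_bcontfun u s" for u and s :: real
  define I where "I u t = integral {0..t} (\<lambda>s. G s (Y u s))" for u t
  \<comment> \<open>Clamping the time at \<open>0\<close> extends the operator continuously to negative times.\<close>
  define \<phi> where "\<phi> u t = exp (- c * max 0 t) *\<^sub>R I u (max 0 t)" for u t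
  have Y_cont: "continuous_on UNIV (Y u)" for u
    unfolding Y_def by (intro continuous_intros) auto
  have Y_int: "(\<lambda>s. G s (Y u s)) integrable_on {0..t}" if "0 \<le> t" for u t
    using int[OF Y_cont that] .
  have I_lip: "norm (I u b - I u a) \<le> B * (b - a)" if "0 \<le> a" "a \<le> b" for u a b
    unfolding I_def using that Y_int bound by (intro indefinite_integral_lipschitz) auto
  have \<phi>_bcont: "\<phi> u \<in> bcontfun" for u
  proof (rule bcontfun_normI)
    have "B-lipschitz_on {0..} (I u)"
    proof (rule lipschitz_onI)
      fix a b :: real assume "a \<in> {0..}" "b \<in> {0..}"
      then show "dist (I u a) (I u b) \<le> B * dist a b"
        using I_lip[of a b u] I_lip[of b a u] by (cases "a \<le> b") (auto simp: dist_norm norm_minus_commute)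
    qed fact
    then have "continuous_on {0..} (I u)" by (rule lipschitz_on_continuous_on)
    then have "continuous_on UNIV (\<lambda>t. I u (max 0 t))"
      by (rule continuous_on_compose2) (auto intro!: continuous_intros)
    then show "continuous_on UNIV (\<phi> u)"
      unfolding \<phi>_def by (intro continuous_intros) auto
    show "norm (\<phi> u t) \<le> B" for t
    proof -
      define \<tau> where "\<tau> = max 0 t"
      have "0 \<le> \<tau>" by (simp add: \<tau>_def)
      have "norm (I u \<tau>) \<le> B * \<tau>"
        using I_lip[of 0 \<tau> u] \<open>0 \<le> \<tau>\<close> by (simp add: I_def)
      also have "\<dots> \<le> B * exp (c * \<tau>)"
      proof -
        have "\<tau> \<le> c * \<tau>" using c(1) \<open>0 \<le> \<tau>\<close> by (simp add: mult_le_cancel_right1)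
        also have "\<dots> \<le> exp (c * \<tau>)" using exp_ge_add_one_self[of "c * \<tau>"] by linarith
        finally show ?thesis using \<open>0 \<le> B\<close> by (intro mult_left_mono)
      qed
      finally have "exp (- c * \<tau>) * norm (I u \<tau>) \<le> exp (- c * \<tau>) * (B * exp (c * \<tau>))"
        by (intro mult_left_mono) auto
      also have "\<dots> = B" by (simp add: exp_minus)
      finally show ?thesis by (simp add: \<phi>_def \<tau>_def)
    qed
  qed
  define \<Phi> where "\<Phi> u = Bcontfun (\<phi> u)" for u
  have \<Phi>: "apply_bcontfun (\<Phi> u) = \<phi> u" for u
    unfolding \<Phi>_def by (rule Bcontfun_inverse[OF \<phi>_bcont])
  have "dist (\<Phi> u) (\<Phi> v) \<le> 1 / 2 * dist u v" for u v
  proof (rule dist_bound)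
    fix t :: real
    define \<tau> where "\<tau> = max 0 t"
    have "0 \<le> \<tau>" by (simp add: \<tau>_def)
    have "norm (I u \<tau> - I v \<tau>) = norm (integral {0..\<tau>} (\<lambda>s. G s (Y u s) - G s (Y v s)))"
      unfolding I_def using Y_int[OF \<open>0 \<le> \<tau>\<close>] by (simp add: Henstock_Kurzweil_Integration.integral_diff)
    also have "\<dots> \<le> integral {0..\<tau>} (\<lambda>s. L * dist u v * exp (c * s))"
    proof (rule integral_norm_bound_integral)
      fix s assume "s \<in> {0..\<tau>}"
      then have "norm (G s (Y u s) - G s (Y v s)) \<le> L * norm (Y u s - Y v s)"
        by (intro lip) auto
      also have "norm (Y u s - Y v s) = exp (c * s) * dist (u s) (v s)"
        unfolding Y_def dist_norm by (simp flip: scaleR_diff_right)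
      also have "L * \<dots> \<le> L * (exp (c * s) * dist u v)"
        using \<open>0 \<le> L\<close> by (intro mult_left_mono dist_bounded) auto
      finally show "norm (G s (Y u s) - G s (Y v s)) \<le> L * dist u v * exp (c * s)"
        by (simp add: mult_ac)
    next
      show "(\<lambda>s. L * dist u v * exp (c * s)) integrable_on {0..\<tau>}"
        by (intro integrable_continuous_real continuous_intros)
    qed (use Y_int[OF \<open>0 \<le> \<tau>\<close>] in \<open>auto intro: integrable_diff\<close>)
    also have "\<dots> = L * dist u v * integral {0..\<tau>} (\<lambda>s. exp (c * s))"
      by simp
    also have "\<dots> \<le> L * dist u v * (exp (c * \<tau>) / c)"
      using \<open>0 \<le> L\<close> c(1) \<open>0 \<le> \<tau>\<close> by (intro mult_left_mono integral_exp_linear_le) auto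
    finally have "exp (- c * \<tau>) * norm (I u \<tau> - I v \<tau>) \<le> exp (- c * \<tau>) * (L * dist u v * (exp (c * \<tau>) / c))"
      by (intro mult_left_mono) auto
    also have "\<dots> = L / c * dist u v" by (simp add: exp_minus)
    also have "\<dots> \<le> 1 / 2 * dist u v" using c(2) by (intro mult_right_mono) auto
    finally show "dist (\<Phi> u t) (\<Phi> v t) \<le> 1 / 2 * dist u v"
      unfolding \<Phi> \<phi>_def dist_norm \<tau>_def[symmetric] by (simp flip: scaleR_diff_right)
  qed
  then have "\<exists>!u. \<Phi> u = u"
    by (intro banach_fix_type[of "1 / 2"]) auto
  then obtain u where u: "\<Phi> u = u" by blast
  show thesis
  proof (rule that[OF Y_cont])
    fix t :: real assume "0 \<le> t"
    have "u t = \<phi> u t" using \<Phi>[of u] by (simp add: u)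
    then have "exp (c * t) *\<^sub>R u t = I u t"
      using \<open>0 \<le> t\<close> by (simp add: \<phi>_def exp_minus)
    then show "Y u t = x0 + integral {0..t} (\<lambda>s. G s (Y u s))"
      unfolding I_def[symmetric] by (simp add: Y_def)
  qed
qed

lemma isCont_switched_field:
  fixes s :: "real \<Rightarrow> 'a::discrete_topology"
  assumes "isCont s t" "isCont x t" "isCont (g (s t)) (x t)"
  shows "isCont (\<lambda>u. g (s u) (x u)) t"
proof -
  have "eventually (\<lambda>u. g (s u) (x u) = g (s t) (x u)) (nhds t)"
    using isCont_locally_constantD[OF assms(1)] by eventually_elim simp
  then have "isCont (\<lambda>u. g (s u) (x u)) t \<longleftrightarrow> isCont (\<lambda>u. g (s t) (x u)) t"
    by (rule isCont_cong)
  then show ?thesis using isCont_o2[OF assms(2,3)] by simp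
qed

text \<open>
  The integrand is bounded and continuous off the finitely many switches, hence measurable.
\<close>

lemma switched_field_integrable:
  fixes s :: "real \<Rightarrow> 'a::discrete_topology" and g :: "'a \<Rightarrow> 'b::euclidean_space \<Rightarrow> 'b"
  assumes s: "cadlag s" "\<And>t. 0 \<le> t \<Longrightarrow> s t \<in> P"
    and g: "\<And>p. p \<in> P \<Longrightarrow> continuous_on UNIV (g p)" "\<And>p y. p \<in> P \<Longrightarrow> norm (g p y) \<le> B"
    and x: "continuous_on UNIV x"
  shows "(\<lambda>t. g (s t) (x t)) integrable_on {0..T}"
proof -
  \<comment> \<open>At negative times the path is arbitrary, so the integrand is set to \<open>0\<close> off the interval.\<close>
  define h where "h t = (if t \<in> {0<..<T} then g (s t) (x t) else 0)" for t
  define X where "X = insert 0 (insert T {u \<in> {0<..T}. \<not> isCont s u})"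
  have "finite X" unfolding X_def using finite_discontinuities[OF s(1)] by simp
  have "isCont h t" if t: "t \<notin> X" for t
  proof -
    consider "t < 0" | "t > T" | "0 < t" "t < T"
      using t by (force simp: X_def)
    then show ?thesis
    proof cases
      case 1
      then show ?thesis
        by (intro isCont_if_locally_constant[of "t - 1" t 0 h 0]) (auto simp: h_def)
    next
      case 2
      then show ?thesis
        by (intro isCont_if_locally_constant[of T t "t + 1" h 0]) (auto simp: h_def)
    next
      case 3
      have "eventually (\<lambda>u. u \<in> {0<..<T}) (nhds t)"
        using 3 by (intro eventually_nhds_in_open) auto
      then have "eventually (\<lambda>u. h u = g (s u) (x u)) (nhds t)"
        by eventually_elim (simp add: h_def)
      then have "isCont h t \<longleftrightarrow> isCont (\<lambda>u. g (s u) (x u)) t"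
        by (rule isCont_cong)
      moreover have "isCont s t" using 3 t by (auto simp: X_def)
      moreover have "isCont x t" "isCont (g (s t)) (x t)"
        using x g(1)[OF s(2)[of t]] 3 by (auto simp: continuous_on_eq_continuous_at)
      ultimately show ?thesis using isCont_switched_field by blast
    qed
  qed
  then have "continuous_on (- X) h"
    by (intro continuous_at_imp_continuous_on) auto
  then have "h \<in> borel_measurable borel"
    using \<open>finite X\<close> by (intro borel_measurable_continuous_countable_exceptions[of X]) (auto intro: countable_finite)
  then have "h \<in> borel_measurable (lebesgue_on {0..T})"
    by (intro measurable_restrict_space1 measurable_completion) simp
  then have "h integrable_on {0..T}"
  proof (rule measurable_bounded_by_integrable_imp_integrable)
    show "(\<lambda>_. \<bar>B\<bar>) integrable_on {0..T}" by (rule integrable_const_ivl)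
    show "norm (h t) \<le> \<bar>B\<bar>" for t
      using g(2)[OF s(2)[of t], of "x t"] by (auto simp: h_def)
  qed simp
  moreover have "g (s t) (x t) = h t" if "t \<in> {0..T} - {0, T}" for t
    using that by (auto simp: h_def)
  ultimately show ?thesis
    using integrable_spike_finite[of "{0, T}" "{0..T}" "\<lambda>t. g (s t) (x t)" h] by blast
qed

definition cutoff :: "real \<Rightarrow> 'a::real_normed_vector \<Rightarrow> real" where
  "cutoff R x = max 0 (min 1 (R + 1 - norm x))"

lemma cutoff_bounds: "0 \<le> cutoff R x" "cutoff R x \<le> 1"
  by (auto simp: cutoff_def)

lemma cutoff_inside: "norm x \<le> R \<Longrightarrow> cutoff R x = 1"
  by (auto simp: cutoff_def)

lemma cutoff_outside: "norm x \<ge> R + 1 \<Longrightarrow> cutoff R x = 0"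
  by (auto simp: cutoff_def)

lemma cutoff_lipschitz: "\<bar>cutoff R x - cutoff R y\<bar> \<le> norm (x - y)"
proof -
  have clip: "\<bar>max 0 (min 1 a) - max 0 (min 1 b)\<bar> \<le> \<bar>a - b\<bar>" for a b :: real
    by linarith
  have "\<bar>cutoff R x - cutoff R y\<bar> \<le> \<bar>norm x - norm y\<bar>"
    using clip[of "R + 1 - norm x" "R + 1 - norm y"] by (simp add: cutoff_def abs_minus_commute)
  then show ?thesis
    using norm_triangle_ineq3[of x y] by linarith
qed

lemma cutoff_field_bound:
  fixes g :: "'a::real_normed_vector \<Rightarrow> 'b::real_normed_vector"
  assumes "\<And>x. norm x \<le> R + 1 \<Longrightarrow> norm (g x) \<le> B" "0 \<le> B"
  shows "norm (cutoff R x *\<^sub>R g x) \<le> B"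
proof (cases "norm x \<le> R + 1")
  case True
  have "cutoff R x * norm (g x) \<le> 1 * B"
    using assms True cutoff_bounds[of R x] by (intro mult_mono) auto
  then show ?thesis using cutoff_bounds[of R x] by simp
next
  case False
  then show ?thesis using assms by (simp add: cutoff_outside)
qed

text \<open>
  If one point lies outside the larger ball, the cut-off field vanishes there and the difference is controlled
  by the Lipschitz cut-off alone; so a Lipschitz constant of \<open>g\<close> on the ball is enough.
\<close>

lemma cutoff_field_lipschitz:
  fixes g :: "'a::real_normed_vector \<Rightarrow> 'b::real_normed_vector"
  assumes g: "\<And>x. norm x \<le> R + 1 \<Longrightarrow> norm (g x) \<le> B" and "0 \<le> B" "0 \<le> L"
    and lip: "L-lipschitz_on (cball 0 (R + 1)) g"
  shows "norm (cutoff R x *\<^sub>R g x - cutoff R y *\<^sub>R g y) \<le> (L + B) * norm (x - y)"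
proof -
  have half: "norm (cutoff R x *\<^sub>R g x - cutoff R y *\<^sub>R g y) \<le> B * norm (x - y)"
    if x: "norm x \<le> R + 1" and y: "norm y > R + 1" for x y
  proof -
    have "norm (cutoff R x *\<^sub>R g x - cutoff R y *\<^sub>R g y) = \<bar>cutoff R x - cutoff R y\<bar> * norm (g x)"
      using y by (simp add: cutoff_outside)
    also have "\<dots> \<le> norm (x - y) * B"
      using cutoff_lipschitz g[OF x] by (intro mult_mono) auto
    finally show ?thesis by (simp add: mult.commute)
  qed
  have weaken: "B * norm (x - y) \<le> (L + B) * norm (x - y)"
    using \<open>0 \<le> L\<close> by (intro mult_right_mono) auto
  consider "norm x \<le> R + 1" "norm y \<le> R + 1" | "norm x \<le> R + 1" "norm y > R + 1"
    | "norm x > R + 1" "norm y \<le> R + 1" | "norm x > R + 1" "norm y > R + 1"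
    by linarith
  then show ?thesis
  proof cases
    case 1
    have "cutoff R x *\<^sub>R g x - cutoff R y *\<^sub>R g y
        = cutoff R x *\<^sub>R (g x - g y) + (cutoff R x - cutoff R y) *\<^sub>R g y"
      by (simp add: algebra_simps)
    also have "norm \<dots> \<le> cutoff R x * norm (g x - g y) + \<bar>cutoff R x - cutoff R y\<bar> * norm (g y)"
      by (rule order_trans[OF norm_triangle_ineq]) (simp add: cutoff_bounds(1))
    also have "\<dots> \<le> 1 * (L * norm (x - y)) + norm (x - y) * B"
      using cutoff_bounds[of R x] cutoff_lipschitz[of R x y] g[OF 1(2)] lip 1
      by (intro add_mono mult_mono) (auto simp: lipschitz_on_def dist_norm)
    finally show ?thesis by (simp add: algebra_simps)
  next
    case 2
    then show ?thesis using half[of x y] weaken by linarith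
  next
    case 3
    then show ?thesis using half[of y x] weaken by (simp add: norm_minus_commute)
  next
    case 4
    then show ?thesis using assms by (simp add: cutoff_outside)
  qed
qed

text \<open>
  The derivative exists, two-sided, wherever the path is continuous, since the integrand is continuous there.
\<close>

lemma cutoff_switched_solution:
  fixes s :: "real \<Rightarrow> 'a::discrete_topology" and f :: "'a \<Rightarrow> real ^ 'n \<Rightarrow> real ^ 'n"
  assumes P: "finite P" "\<And>p. p \<in> P \<Longrightarrow> locally_lipschitz (f p)"
    and s: "cadlag s" "\<And>t. 0 \<le> t \<Longrightarrow> s t \<in> P"
  obtains z where "z 0 = x0" "\<And>T. absolutely_continuous_on_interval 0 T z"
    "\<And>t. 0 < t \<Longrightarrow> isCont s t \<Longrightarrow> (z has_vector_derivative cutoff R (z t) *\<^sub>R f (s t) (z t)) (at t)"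
proof -
  let ?K = "cball (0 :: real ^ 'n) (R + 1)"
  obtain L where L: "0 \<le> L" "\<And>p. p \<in> P \<Longrightarrow> L-lipschitz_on ?K (f p)"
    using uniformly_lipschitz_on_compact[of P f ?K] P by auto
  have "bounded (\<Union>p\<in>P. f p ` ?K)"
    using P(1) L(2)
    by (intro bounded_UN ballI compact_imp_bounded compact_continuous_image)
       (auto intro: lipschitz_on_continuous_on)
  then obtain B where B: "0 < B" "\<And>p y. p \<in> P \<Longrightarrow> norm y \<le> R + 1 \<Longrightarrow> norm (f p y) \<le> B"
    unfolding bounded_pos by fastforce
  define g where "g p y = cutoff R y *\<^sub>R f p y" for p y
  have g_bound: "norm (g p y) \<le> B" if "p \<in> P" for p y
    unfolding g_def using B that by (intro cutoff_field_bound) auto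
  have g_lip: "norm (g p x - g p y) \<le> (L + B) * norm (x - y)" if "p \<in> P" for p x y
    unfolding g_def using B L that by (intro cutoff_field_lipschitz) auto
  have g_cont: "continuous_on UNIV (g p)" if "p \<in> P" for p
  proof (rule lipschitz_on_continuous_on)
    show "(L + B)-lipschitz_on UNIV (g p)"
      using g_lip[OF that] B(1) L(1) by (intro lipschitz_onI) (auto simp: dist_norm)
  qed
  have int: "(\<lambda>u. g (s u) (x u)) integrable_on {0..t}" if "continuous_on UNIV x" for x t
    using s g_cont g_bound that by (rule switched_field_integrable)
  obtain z where z: "continuous_on UNIV z"
    "\<And>t. 0 \<le> t \<Longrightarrow> z t = x0 + integral {0..t} (\<lambda>u. g (s u) (z u))"
  proof (rule picard_global_solution[of "L + B" "\<lambda>t. g (s t)" B x0])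
    show "0 \<le> L + B" using L B by simp
  qed (use g_lip g_bound s(2) int in auto)
  show thesis
  proof (rule that)
    show "z 0 = x0" using z(2)[of 0] by simp
    show "absolutely_continuous_on_interval 0 T z" for T
    proof (rule lipschitz_imp_absolutely_continuous)
      fix u v :: real assume uv: "0 \<le> u" "u \<le> v"
      then have "norm (integral {0..v} (\<lambda>u. g (s u) (z u)) - integral {0..u} (\<lambda>u. g (s u) (z u))) \<le> B * (v - u)"
        using g_bound s(2) by (intro indefinite_integral_lipschitz int z(1)) auto
      then show "norm (z v - z u) \<le> B * (v - u)"
        using z(2)[of u] z(2)[of v] uv by simp
    qed
    fix t :: real assume t: "0 < t" "isCont s t"
    have "isCont (\<lambda>u. g (s u) (z u)) t"
    proof (rule isCont_switched_field[where g = g and s = s and x = z])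
      show "isCont z t" "isCont (g (s t)) (z t)"
        using z(1) g_cont[of "s t"] s(2)[of t] t(1) by (simp_all add: continuous_on_eq_continuous_at)
    qed (rule t(2))
    then have cont: "continuous (at t within ({0..t + 1} - {})) (\<lambda>u. g (s u) (z u))"
      by (rule continuous_at_imp_continuous_at_within)
    have "((\<lambda>v. integral {0..v} (\<lambda>u. g (s u) (z u))) has_vector_derivative g (s t) (z t))
        (at t within {0..t + 1} - {})"
      by (rule integral_has_vector_derivative_continuous_at[OF int[OF z(1)] _ _ cont]) (use t in auto)
    then have "((\<lambda>v. integral {0..v} (\<lambda>u. g (s u) (z u))) has_vector_derivative g (s t) (z t))
        (at t within {0<..<t + 1})"
      by (rule has_vector_derivative_within_subset) auto
    then have "((\<lambda>v. integral {0..v} (\<lambda>u. g (s u) (z u))) has_vector_derivative g (s t) (z t)) (at t)"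
      using t by (simp add: at_within_open[of t "{0<..<t + 1}"])
    from has_vector_derivative_add[OF has_vector_derivative_const[of x0] this]
    have "((\<lambda>v. x0 + integral {0..v} (\<lambda>u. g (s u) (z u))) has_vector_derivative g (s t) (z t)) (at t)"
      by simp
    then show "(z has_vector_derivative cutoff R (z t) *\<^sub>R f (s t) (z t)) (at t)"
      unfolding g_def[symmetric]
      by (rule has_vector_derivative_transform_within_open[of _ _ _ "{0<..}"]) (use t z(2) in auto)
  qed
qed

section \<open>Lyapunov functions along a switching path\<close>

lemma exponential_decay:
  fixes W :: "real \<Rightarrow> real"
  assumes "a \<le> b" "continuous_on {a..b} W"
    and deriv: "\<And>t. a < t \<Longrightarrow> t < b \<Longrightarrow> \<exists>d. (W has_real_derivative d) (at t) \<and> d \<le> - \<kappa> * W t"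
  shows "W b \<le> exp (- \<kappa> * (b - a)) * W a"
proof -
  have "exp (\<kappa> * b) * W b \<le> exp (\<kappa> * a) * W a"
  proof (rule DERIV_nonpos_imp_decreasing_open[OF \<open>a \<le> b\<close>, where f = "\<lambda>t. exp (\<kappa> * t) * W t"])
    fix t assume t: "a < t" "t < b"
    obtain d where d: "(W has_real_derivative d) (at t)" "d \<le> - \<kappa> * W t"
      using deriv[OF t] by blast
    have "((\<lambda>t. exp (\<kappa> * t) * W t) has_real_derivative exp (\<kappa> * t) * (\<kappa> * W t + d)) (at t)"
      by (auto intro!: derivative_eq_intros d(1) simp: algebra_simps)
    moreover have "exp (\<kappa> * t) * (\<kappa> * W t + d) \<le> 0"
      using d(2) by (intro mult_nonneg_nonpos) auto
    ultimately show "\<exists>y. ((\<lambda>t. exp (\<kappa> * t) * W t) has_real_derivative y) (at t) \<and> y \<le> 0"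
      by blast
  qed (intro continuous_intros assms(2))
  then have "exp (- \<kappa> * b) * (exp (\<kappa> * b) * W b) \<le> exp (- \<kappa> * b) * (exp (\<kappa> * a) * W a)"
    by (intro mult_left_mono) auto
  moreover have "exp (- \<kappa> * b) * exp (\<kappa> * b) = 1" "exp (- \<kappa> * b) * exp (\<kappa> * a) = exp (- \<kappa> * (b - a))"
    unfolding exp_add[symmetric] by (simp_all add: algebra_simps)
  ultimately show ?thesis
    by (metis mult.assoc mult_1)
qed

text \<open>
  Induction on the number of switches, peeling off the last one: after it the active function decays, at it the
  factor \<open>\<mu>\<close> is lost, and just before it the old function decays from a time with one switch
  less, where the induction hypothesis applies. The functions \<open>W p\<close> are continuous across switches
  because the trajectory does not jump.
\<close>

lemma switched_lyapunov_bound: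
  fixes W :: "nat \<Rightarrow> real \<Rightarrow> real"
  assumes s: "cadlag s" "\<And>t. 0 \<le> t \<Longrightarrow> s t \<in> P" and "0 \<le> \<mu>"
    and cont: "\<And>p. p \<in> P \<Longrightarrow> continuous_on {0..T} (W p)"
    and switch: "\<And>p q t. p \<in> P \<Longrightarrow> q \<in> P \<Longrightarrow> 0 \<le> t \<Longrightarrow> t \<le> T \<Longrightarrow> W p t \<le> \<mu> * W q t"
    and deriv: "\<And>t. 0 < t \<Longrightarrow> t < T \<Longrightarrow> isCont s t \<Longrightarrow>
      \<exists>d. (W (s t) has_real_derivative d) (at t) \<and> d \<le> - \<kappa> * W (s t) t"
    and t: "0 \<le> t" "t \<le> T"
  shows "W (s t) t \<le> \<mu> ^ num_switches s t * exp (- \<kappa> * t) * W (s 0) 0"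
  using t
proof (induction "num_switches s t" arbitrary: t rule: less_induct)
  case less
  define S where "S t = {u \<in> {0<..t}. \<not> isCont s u}" for t
  have fin: "finite (S t)" for t
    unfolding S_def by (rule finite_discontinuities[OF s(1)])
  have N: "num_switches s t = card (S t)" for t
    by (simp add: num_switches_def S_def)
  have decay: "W p b \<le> exp (- \<kappa> * (b - a)) * W p a"
    if "0 \<le> a" "a \<le> b" "b \<le> T" "p \<in> P" and p: "\<And>v. a < v \<Longrightarrow> v < b \<Longrightarrow> isCont s v \<and> s v = p" for a b p
  proof (rule exponential_decay[OF \<open>a \<le> b\<close>])
    show "continuous_on {a..b} (W p)"
      using cont[OF \<open>p \<in> P\<close>] by (rule continuous_on_subset) (use that in auto)
    fix v assume v: "a < v" "v < b"
    then have "isCont s v" "s v = p" using p by auto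
    then show "\<exists>d. (W p has_real_derivative d) (at v) \<and> d \<le> - \<kappa> * W p v"
      using deriv[of v] v that(1,3) by auto
  qed
  show ?case
  proof (cases "S t = {}")
    case True
    have noswitch: "isCont s v" if "0 < v" "v \<le> t" for v
      using True that unfolding S_def by auto
    have "s t = s 0"
      using True less.prems unfolding S_def by (intro eq_if_no_switch s(1)) auto
    moreover have "W (s 0) t \<le> exp (- \<kappa> * (t - 0)) * W (s 0) 0"
    proof (rule decay)
      fix v assume v: "0 < v" "v < t"
      show "isCont s v \<and> s v = s 0"
        using noswitch v constant_between_switches[OF s(1), of 0 t v] by auto
    qed (use s(2) less.prems in auto)
    ultimately show ?thesis
      using True by (simp add: N)
  next
    case False
    define u where "u = Max (S t)"
    have uS: "u \<in> S t" and u_max: "\<And>v. v \<in> S t \<Longrightarrow> v \<le> u"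
      using False fin by (auto simp: u_def)
    then have u: "0 < u" "u \<le> t" "\<not> isCont s u" by (auto simp: S_def)
    have after: "isCont s v" if "u < v" "v \<le> t" for v
      using u_max[of v] that u by (auto simp: S_def)
    obtain a l where a: "0 \<le> a" "a < u" and al: "\<And>v. a < v \<Longrightarrow> v < u \<Longrightarrow> s v = l"
      using cadlag_eventually_left[OF s(1) u(1)] by blast
    have before: "isCont s v" if "a < v" "v < u" for v
      using that al by (rule isCont_if_locally_constant)
    \<comment> \<open>Any time strictly between \<open>a\<close> and the last switch \<open>u\<close> serves.\<close>
    define b where "b = (a + u) / 2"
    have b: "a < b" "b < u" "0 < b" using a by (auto simp: b_def)
    have sb: "s b = l" using al b by blast
    have "l \<in> P" using s(2)[of b] b sb by simp
    have S_insert: "S t = insert u (S b)"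
    proof -
      have "v = u \<or> v \<le> b" if "v \<in> S t" for v
        using u_max[OF that] before[of v] that b by (force simp: S_def)
      then show ?thesis using u b by (auto simp: S_def)
    qed
    have "u \<notin> S b" using b by (auto simp: S_def)
    then have card: "num_switches s t = Suc (num_switches s b)"
      using fin by (simp add: N S_insert)
    have "s t = s u"
      using u after by (intro eq_if_no_switch s(1)) auto
    have "W (s u) t \<le> exp (- \<kappa> * (t - u)) * W (s u) u"
    proof (rule decay)
      fix v assume v: "u < v" "v < t"
      show "isCont s v \<and> s v = s u"
        using after v u constant_between_switches[OF s(1), of u t v] by auto
    qed (use s(2) u less.prems in auto)
    also have "\<dots> \<le> exp (- \<kappa> * (t - u)) * (\<mu> * W l u)"
      using switch[of "s u" l u] s(2)[of u] \<open>l \<in> P\<close> u less.prems by (intro mult_left_mono) auto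
    also have "\<dots> \<le> exp (- \<kappa> * (t - u)) * (\<mu> * (exp (- \<kappa> * (u - b)) * W l b))"
    proof -
      have "W l u \<le> exp (- \<kappa> * (u - b)) * W l b"
        using b u less.prems \<open>l \<in> P\<close> al before a by (intro decay) auto
      then show ?thesis using \<open>0 \<le> \<mu>\<close> by (intro mult_left_mono) auto
    qed
    also have "\<dots> \<le> exp (- \<kappa> * (t - u)) * (\<mu> * (exp (- \<kappa> * (u - b)) *
        (\<mu> ^ num_switches s b * exp (- \<kappa> * b) * W (s 0) 0)))"
    proof -
      have "W (s b) b \<le> \<mu> ^ num_switches s b * exp (- \<kappa> * b) * W (s 0) 0"
        using card b u less.prems by (intro less.hyps) auto
      then show ?thesis using \<open>0 \<le> \<mu>\<close> sb by (intro mult_left_mono) auto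
    qed
    also have "\<dots> = \<mu> ^ num_switches s t * (exp (- \<kappa> * (t - u)) * exp (- \<kappa> * (u - b)) * exp (- \<kappa> * b)) * W (s 0) 0"
      by (simp add: card)
    also have "exp (- \<kappa> * (t - u)) * exp (- \<kappa> * (u - b)) * exp (- \<kappa> * b) = exp (- \<kappa> * t)"
      by (simp add: exp_add[symmetric] algebra_simps)
    finally show ?thesis by (simp add: \<open>s t = s u\<close>)
  qed
qed

section \<open>Trajectories and their decay\<close>

text \<open>
  The hypotheses of the stability theorem that do not involve chance, so that trajectories can be treated path
  by path.
\<close>

locale switched_lyapunov_system =
  fixes P :: "nat set"
    and f :: "nat \<Rightarrow> real ^ 'n \<Rightarrow> real ^ 'n"
    and V :: "nat \<Rightarrow> real ^ 'n \<Rightarrow> real"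
    and \<alpha>\<^sub>1 \<alpha>\<^sub>2 :: "real \<Rightarrow> real"
    and \<rho> \<mu> :: real
  assumes finite_P: "finite P"
    and f_lipschitz: "\<And>p. p \<in> P \<Longrightarrow> locally_lipschitz (f p)"
    and V_differentiable: "\<And>p x. p \<in> P \<Longrightarrow> V p differentiable (at x)"
    and \<alpha>\<^sub>1: "class_K_inf \<alpha>\<^sub>1"
    and rate_pos: "\<rho> > 0" and gain_ge_1: "\<mu> \<ge> 1"
    and V_bounds: "\<And>p x. p \<in> P \<Longrightarrow> \<alpha>\<^sub>1 (norm x) \<le> V p x \<and> V p x \<le> \<alpha>\<^sub>2 (norm x)"
    and V_dissipation: "\<And>p x. p \<in> P \<Longrightarrow> frechet_derivative (V p) (at x) (f p x) \<le> - \<rho> * V p x"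
    and V_compare: "\<And>p q x. p \<in> P \<Longrightarrow> q \<in> P \<Longrightarrow> V p x \<le> \<mu> * V q x"
begin

lemma \<alpha>\<^sub>1_mono: "0 \<le> r \<Longrightarrow> r < r' \<Longrightarrow> \<alpha>\<^sub>1 r < \<alpha>\<^sub>1 r'"
  using \<alpha>\<^sub>1 unfolding class_K_inf_def class_K_def by (auto intro: strict_mono_onD)

lemma \<alpha>\<^sub>1_nonneg: "0 \<le> r \<Longrightarrow> 0 \<le> \<alpha>\<^sub>1 r"
  using \<alpha>\<^sub>1_mono[of 0 r] \<alpha>\<^sub>1 unfolding class_K_inf_def class_K_def by (cases "r = 0") auto

lemma V_nonneg: "p \<in> P \<Longrightarrow> 0 \<le> V p x"
  using V_bounds[of p x] \<alpha>\<^sub>1_nonneg[of "norm x"] by auto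

text \<open>
  The factor \<open>c\<close> allows for cut-off fields: with \<open>c\<close> between \<open>0\<close> and
  \<open>1\<close> the bound holds for \<open>\<kappa> = 0\<close>, and with \<open>c = 1\<close>, for the
  system itself, it holds for \<open>\<kappa> = \<rho>\<close>.
\<close>

lemma trajectory_bound:
  assumes s: "cadlag s" "\<And>t. 0 \<le> t \<Longrightarrow> s t \<in> P"
    and z: "continuous_on {0..T} z"
    and deriv: "\<And>t. 0 < t \<Longrightarrow> t < T \<Longrightarrow> isCont s t \<Longrightarrow>
      (z has_vector_derivative c t *\<^sub>R f (s t) (z t)) (at t)"
    and c: "\<And>t. 0 \<le> c t" "\<And>t. \<kappa> \<le> c t * \<rho>"
    and t: "0 \<le> t" "t \<le> T"
  shows "\<alpha>\<^sub>1 (norm (z t)) \<le> \<mu> ^ num_switches s t * exp (- \<kappa> * t) * \<alpha>\<^sub>2 (norm (z 0))"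
proof -
  have "V (s t) (z t) \<le> \<mu> ^ num_switches s t * exp (- \<kappa> * t) * V (s 0) (z 0)"
  proof (rule switched_lyapunov_bound[where W = "\<lambda>p t. V p (z t)" and P = P and T = T])
    fix p assume "p \<in> P"
    then have "continuous_on UNIV (V p)"
      using V_differentiable by (intro differentiable_imp_continuous_on) (simp add: differentiable_on_def)
    then show "continuous_on {0..T} (\<lambda>t. V p (z t))"
      using z by (rule continuous_on_compose2) auto
  next
    fix t assume t: "0 < t" "t < T" "isCont s t"
    let ?D = "frechet_derivative (V (s t)) (at (z t))"
    have "s t \<in> P" using s(2) t by simp
    then have D: "(V (s t) has_derivative ?D) (at (z t))"
      using V_differentiable frechet_derivative_works by blast
    have "(V (s t) \<circ> z has_vector_derivative ?D (c t *\<^sub>R f (s t) (z t))) (at t)"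
      using deriv[OF t] by (rule vector_derivative_diff_chain_within) (rule has_derivative_at_withinI[OF D])
    then have "((\<lambda>u. V (s t) (z u)) has_real_derivative ?D (c t *\<^sub>R f (s t) (z t))) (at t)"
      by (simp add: has_real_derivative_iff_has_vector_derivative o_def)
    moreover have "?D (c t *\<^sub>R f (s t) (z t)) \<le> - \<kappa> * V (s t) (z t)"
    proof -
      have "?D (c t *\<^sub>R f (s t) (z t)) = c t * ?D (f (s t) (z t))"
        using linear_scale[OF has_derivative_linear[OF D]] by simp
      also have "\<dots> \<le> c t * (- \<rho> * V (s t) (z t))"
        using V_dissipation[OF \<open>s t \<in> P\<close>] c(1) by (intro mult_left_mono)
      also have "\<dots> = - (c t * \<rho>) * V (s t) (z t)" by simp
      also have "\<dots> \<le> - \<kappa> * V (s t) (z t)"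
        using c(2)[of t] V_nonneg[OF \<open>s t \<in> P\<close>] by (intro mult_right_mono) auto
      finally show ?thesis .
    qed
    ultimately show "\<exists>d. ((\<lambda>u. V (s t) (z u)) has_real_derivative d) (at t) \<and> d \<le> - \<kappa> * V (s t) (z t)"
      by blast
  qed (use s V_compare gain_ge_1 t in auto)
  also have "\<dots> \<le> \<mu> ^ num_switches s t * exp (- \<kappa> * t) * \<alpha>\<^sub>2 (norm (z 0))"
    using V_bounds[OF s(2)[of 0]] gain_ge_1 by (intro mult_left_mono) auto
  finally show ?thesis using V_bounds[OF s(2)[OF t(1)], of "z t"] by linarith
qed

lemma \<alpha>\<^sub>1_unbounded:
  obtains R where "R > 0" "C < \<alpha>\<^sub>1 R"
proof -
  have "eventually (\<lambda>r. C < \<alpha>\<^sub>1 r \<and> r > 0) at_top"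
    using \<alpha>\<^sub>1 eventually_gt_at_top[of 0] unfolding class_K_inf_def filterlim_at_top_dense
    by (auto intro: eventually_conj)
  then show thesis using that by (auto simp: eventually_at_top_linorder)
qed

text \<open>
  The radius \<open>R\<close> is chosen from the a priori bound at rate \<open>0\<close>, using the number of
  switches up to \<open>T\<close>; the cut-off trajectory then never leaves the ball where the cut-off equals
  \<open>1\<close>.
\<close>

lemma solution_on_interval:
  assumes s: "cadlag s" "\<And>t. 0 \<le> t \<Longrightarrow> s t \<in> P" and "0 \<le> T"
  obtains z where "z 0 = x0" "absolutely_continuous_on_interval 0 T z"
    "\<And>t. 0 < t \<Longrightarrow> t < T \<Longrightarrow> isCont s t \<Longrightarrow> (z has_vector_derivative f (s t) (z t)) (at t)"
proof -
  obtain R where R: "R > 0" "\<mu> ^ num_switches s T * \<alpha>\<^sub>2 (norm x0) < \<alpha>\<^sub>1 R"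
    using \<alpha>\<^sub>1_unbounded by blast
  obtain z where z: "z 0 = x0" "\<And>T. absolutely_continuous_on_interval 0 T z"
    "\<And>t. 0 < t \<Longrightarrow> isCont s t \<Longrightarrow> (z has_vector_derivative cutoff R (z t) *\<^sub>R f (s t) (z t)) (at t)"
    using cutoff_switched_solution[of P f s x0 R, OF finite_P f_lipschitz s] by blast
  have in_ball: "norm (z t) \<le> R" if t: "0 \<le> t" "t \<le> T" for t
  proof -
    have "0 \<le> \<alpha>\<^sub>2 (norm x0)"
      using V_bounds[OF s(2)[of 0], of x0] V_nonneg[OF s(2)[of 0], of x0] by auto
    have "\<alpha>\<^sub>1 (norm (z t)) \<le> \<mu> ^ num_switches s t * exp (- 0 * t) * \<alpha>\<^sub>2 (norm (z 0))"
      using s absolutely_continuous_imp_continuous_on[OF z(2)] z(3) t rate_pos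
      by (intro trajectory_bound[where c = "\<lambda>t. cutoff R (z t)" and T = T]) (auto simp: cutoff_bounds)
    also have "\<dots> \<le> \<mu> ^ num_switches s T * \<alpha>\<^sub>2 (norm x0)"
    proof -
      have "\<mu> ^ num_switches s t \<le> \<mu> ^ num_switches s T"
        using num_switches_mono[OF s(1) t(2)] gain_ge_1 by (rule power_increasing)
      then show ?thesis using \<open>0 \<le> \<alpha>\<^sub>2 (norm x0)\<close> z(1) by (auto intro: mult_right_mono)
    qed
    also have "\<dots> < \<alpha>\<^sub>1 R" by (rule R(2))
    finally show ?thesis using \<alpha>\<^sub>1_mono[of R "norm (z t)"] R(1) by (cases "norm (z t) \<le> R") auto
  qed
  show thesis
  proof (rule that[OF z(1,2)])
    fix t assume "0 < t" "t < T" "isCont s t"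
    then show "(z has_vector_derivative f (s t) (z t)) (at t)"
      using z(3)[of t] in_ball[of t] by (simp add: cutoff_inside)
  qed
qed

text \<open>
  The solutions on \<open>[0, n]\<close> agree with each other by uniqueness, so their union is a solution for
  all times.
\<close>

theorem global_solution:
  assumes s: "cadlag s" "\<And>t. 0 \<le> t \<Longrightarrow> s t \<in> P"
  obtains x where "unique_caratheodory_solution f s x0 x"
    "\<And>t. 0 \<le> t \<Longrightarrow> \<alpha>\<^sub>1 (norm (x t)) \<le> \<mu> ^ num_switches s t * exp (- \<rho> * t) * \<alpha>\<^sub>2 (norm x0)"
proof -
  have "\<exists>z. z 0 = x0 \<and> absolutely_continuous_on_interval 0 (real n) z \<and>
    (\<forall>t. 0 < t \<longrightarrow> t < real n \<longrightarrow> isCont s t \<longrightarrow> (z has_vector_derivative f (s t) (z t)) (at t))" for n :: nat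
    by (rule solution_on_interval[OF s, of "real n" x0]) auto
  then obtain z where z: "\<And>n. z n 0 = x0" "\<And>n. absolutely_continuous_on_interval 0 (real n) (z n)"
    "\<And>n t. 0 < t \<Longrightarrow> t < real n \<Longrightarrow> isCont s t \<Longrightarrow> (z n has_vector_derivative f (s t) (z n t)) (at t)"
    by metis
  have z_ae: "AE t in lborel. 0 < t \<and> t < real n \<longrightarrow> (z n has_vector_derivative f (s t) (z n t)) (at t)" for n
    using AE_no_switch[OF s(1)] by eventually_elim (use z(3) in auto)
  define x where "x t = z (Suc (nat \<lceil>t\<rceil>)) t" for t
  have x_eq: "x t = z n t" if t: "0 \<le> t" "t + 1 \<le> real n" for t n
  proof -
    define m where "m = Suc (nat \<lceil>t\<rceil>)"
    have "\<lceil>t\<rceil> \<le> int n - 1" unfolding ceiling_le_iff using t(2) by simp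
    moreover have "0 \<le> \<lceil>t\<rceil>" using t(1) by simp
    ultimately have "real m \<le> real n" unfolding m_def by linarith
    have "t \<le> 1 + real_of_int \<lceil>t\<rceil>" by linarith
    then have "t \<le> real m" using t(1) by (simp add: m_def)
    have "z m t = z n t"
    proof (rule switched_solution_unique_on_interval[where T = "real m" and x = "z m", OF finite_P f_lipschitz s(2)])
      show "absolutely_continuous_on_interval 0 (real m) (z n)"
        using z(2)[of n] by (rule absolutely_continuous_subinterval) (use \<open>real m \<le> real n\<close> in auto)
      show "AE t in lborel. 0 < t \<and> t < real m \<longrightarrow> (z n has_vector_derivative f (s t) (z n t)) (at t)"
        using z_ae[of n] by eventually_elim (use \<open>real m \<le> real n\<close> in auto)
    qed (use z(1) z(2)[of m] z_ae[of m] t(1) \<open>t \<le> real m\<close> in auto)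
    then show ?thesis by (simp add: x_def m_def)
  qed
  have x0: "x 0 = x0" using x_eq[of 0 1] z(1) by simp
  have x_ac: "absolutely_continuous_on_interval 0 T x" for T
  proof -
    obtain n :: nat where n: "T + 1 \<le> real n" using real_arch_simple by blast
    have "absolutely_continuous_on_interval 0 T (z n)"
      using z(2)[of n] by (rule absolutely_continuous_subinterval) (use n in auto)
    then show ?thesis
      by (rule absolutely_continuous_cong) (use n x_eq in auto)
  qed
  have x_deriv: "(x has_vector_derivative f (s t) (x t)) (at t)" if t: "0 < t" "isCont s t" for t
  proof -
    obtain n :: nat where n: "t + 2 \<le> real n" using real_arch_simple by blast
    then have "(z n has_vector_derivative f (s t) (x t)) (at t)"
      using z(3)[of t n] x_eq[of t n] t by simp
    then show ?thesis
      by (rule has_vector_derivative_transform_within_open[of _ _ _ "{0<..<t + 1}"])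
         (use t n x_eq[of _ n] in auto)
  qed
  have x_sol: "caratheodory_solution f s x0 x"
    unfolding caratheodory_solution_def
    using x0 x_ac AE_no_switch[OF s(1)] by (auto intro: x_deriv elim!: AE_mp)
  have unique: "y t = x t" if y: "caratheodory_solution f s x0 y" and "0 \<le> t" for y t
  proof (rule switched_solution_unique_on_interval[where T = t, OF finite_P f_lipschitz s(2)])
    show "AE u in lborel. 0 < u \<and> u < t \<longrightarrow> (y has_vector_derivative f (s u) (y u)) (at u)"
      using y unfolding caratheodory_solution_def by (auto elim!: AE_mp)
    show "AE u in lborel. 0 < u \<and> u < t \<longrightarrow> (x has_vector_derivative f (s u) (x u)) (at u)"
      using x_sol unfolding caratheodory_solution_def by (auto elim!: AE_mp)
  qed (use y x0 x_ac \<open>0 \<le> t\<close> in \<open>auto simp: caratheodory_solution_def\<close>)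
  show thesis
  proof (rule that)
    show "unique_caratheodory_solution f s x0 x"
      unfolding unique_caratheodory_solution_def using x_sol unique by blast
    fix t :: real assume "0 \<le> t"
    then show "\<alpha>\<^sub>1 (norm (x t)) \<le> \<mu> ^ num_switches s t * exp (- \<rho> * t) * \<alpha>\<^sub>2 (norm x0)"
      unfolding x0[symmetric]
      using s absolutely_continuous_imp_continuous_on[OF x_ac] x_deriv
      by (intro trajectory_bound[where c = "\<lambda>_. 1" and T = t]) auto
  qed
qed

end

section \<open>Measurability of the switch counts\<close>

lemma card_eq_sum_card_grid_cells:
  fixes g :: "nat \<Rightarrow> 'a::linorder"
  assumes "mono g" "finite {u \<in> {g 0<..g m}. P u}"
  shows "card {u \<in> {g 0<..g m}. P u} = (\<Sum>i<m. card {u \<in> {g i<..g (Suc i)}. P u})"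
  using assms(2)
proof (induction m)
  case 0
  then show ?case by simp
next
  case (Suc m)
  have le: "g 0 \<le> g m" "g m \<le> g (Suc m)"
    using assms(1) by (auto simp: mono_def)
  have eq: "{u \<in> {g 0<..g (Suc m)}. P u} = {u \<in> {g 0<..g m}. P u} \<union> {u \<in> {g m<..g (Suc m)}. P u}"
    using le by force
  have "finite {u \<in> {g 0<..g m}. P u}" "finite {u \<in> {g m<..g (Suc m)}. P u}"
    using Suc.prems unfolding eq by auto
  then show ?case
    unfolding eq using Suc.IH by (subst card_Un_disjoint) auto
qed

lemma finite_set_min_gap:
  fixes S :: "real set"
  assumes "finite S"
  obtains d where "d > 0" "\<And>x y. x \<in> S \<Longrightarrow> y \<in> S \<Longrightarrow> x \<noteq> y \<Longrightarrow> d \<le> \<bar>x - y\<bar>"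
proof -
  define D where "D = insert 1 ((\<lambda>(x, y). \<bar>x - y\<bar>) ` {p \<in> S \<times> S. fst p \<noteq> snd p})"
  have "finite D" "D \<noteq> {}" using assms by (auto simp: D_def)
  show thesis
  proof (rule that)
    show "Min D > 0" using \<open>finite D\<close> \<open>D \<noteq> {}\<close> by (auto simp: D_def)
    show "Min D \<le> \<bar>x - y\<bar>" if "x \<in> S" "y \<in> S" "x \<noteq> y" for x y
      using \<open>finite D\<close> that by (intro Min_le) (force simp: D_def)+
  qed
qed

text \<open>
  Once the mesh is finer than the smallest gap between switches, each cell contains at most one of them, and the
  path differs at the ends of the cell exactly if there is one. So the sequence is eventually constant.
\<close>

lemma grid_changes_tendsto_num_switches:
  assumes "cadlag s" "0 \<le> t"
  shows "(\<lambda>m. \<Sum>i<m. of_bool (s (t * real (Suc i) / real m) \<noteq> s (t * real i / real m)) :: real)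
           \<longlonglongrightarrow> real (num_switches s t)"
proof -
  define S where "S = {u \<in> {0<..t}. \<not> isCont s u}"
  have fin: "finite S" unfolding S_def by (rule finite_discontinuities[OF assms(1)])
  obtain d where d: "d > 0" "\<And>x y. x \<in> S \<Longrightarrow> y \<in> S \<Longrightarrow> x \<noteq> y \<Longrightarrow> d \<le> \<bar>x - y\<bar>"
    using finite_set_min_gap[OF fin] by blast
  have "eventually (\<lambda>m. m > 0 \<and> t / d < real m) sequentially"
    using eventually_gt_at_top[of 0] filterlim_real_sequentially[unfolded filterlim_at_top_dense]
    by (auto intro: eventually_conj)
  then have "eventually (\<lambda>m. real (num_switches s t) =
      (\<Sum>i<m. of_bool (s (t * real (Suc i) / real m) \<noteq> s (t * real i / real m)))) sequentially"
  proof eventually_elim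
    case (elim m)
    define g where "g i = t * real i / real m" for i
    have "mono g" using assms elim by (auto simp: mono_def g_def intro!: divide_right_mono mult_left_mono)
    have g0m: "g 0 = 0" "g m = t" using elim by (auto simp: g_def)
    have mesh: "g (Suc i) - g i < d" for i
      using elim d(1) by (auto simp: g_def field_simps)
    have cell: "of_bool (s (g (Suc i)) \<noteq> s (g i)) = card {u \<in> {g i<..g (Suc i)}. \<not> isCont s u}"
      if "i < m" for i
    proof -
      let ?C = "{u \<in> {g i<..g (Suc i)}. \<not> isCont s u}"
      have "g 0 \<le> g i" "g i \<le> g (Suc i)" "g (Suc i) \<le> g m"
        using \<open>mono g\<close> \<open>i < m\<close> by (auto intro: monoD)
      then have g: "0 \<le> g i" "g i \<le> g (Suc i)" and sub: "?C \<subseteq> S"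
        unfolding S_def g0m by auto
      have same: "x = y" if "x \<in> ?C" "y \<in> ?C" for x y
      proof (rule ccontr)
        assume "x \<noteq> y"
        then have "d \<le> \<bar>x - y\<bar>" using d(2) that sub by blast
        then show False using mesh[of i] that by auto
      qed
      show ?thesis
      proof (cases "?C = {}")
        case True
        then have "s (g (Suc i)) = s (g i)"
          using g assms(1) by (intro eq_if_no_switch)
        then show ?thesis unfolding True by simp
      next
        case False
        then obtain u where u: "?C = {u}" using same by blast
        then have "s (g (Suc i)) \<noteq> s (g i)"
          using g assms(1) by (intro neq_if_one_switch)
        then show ?thesis unfolding u by simp
      qed
    qed
    have "num_switches s t = (\<Sum>i<m. card {u \<in> {g i<..g (Suc i)}. \<not> isCont s u})"
      using card_eq_sum_card_grid_cells[OF \<open>mono g\<close>, of m "\<lambda>u. \<not> isCont s u"] fin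
      unfolding g0m num_switches_def S_def by simp
    also have "\<dots> = (\<Sum>i<m. of_bool (s (g (Suc i)) \<noteq> s (g i)))"
      using cell by (intro sum.cong) auto
    finally show ?case
      by (simp add: g_def)
  qed
  then show ?thesis
    by (rule tendsto_eventually[OF eventually_mono]) simp
qed

text \<open>
  The number of changes along a fixed grid depends on finitely many values of the process, and the switch count
  is its limit along finer grids.
\<close>

lemma num_switches_measurable:
  assumes meas: "\<And>t. 0 \<le> t \<Longrightarrow> \<sigma> t \<in> measurable M (count_space A)"
    and cadlag: "\<And>\<omega>. \<omega> \<in> space M \<Longrightarrow> cadlag (\<lambda>t. \<sigma> t \<omega>)"
    and "0 \<le> t"
  shows "(\<lambda>\<omega>. num_switches (\<lambda>u. \<sigma> u \<omega>) t) \<in> measurable M (count_space UNIV)"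
proof -
  have \<sigma>_borel: "(\<lambda>\<omega>. real (\<sigma> u \<omega>)) \<in> borel_measurable M" if "0 \<le> u" for u
    by (rule measurable_compose[OF meas[OF that]]) simp
  have changes: "(\<lambda>\<omega>. of_bool (\<sigma> u \<omega> \<noteq> \<sigma> v \<omega>) :: real) \<in> borel_measurable M"
    if "0 \<le> u" "0 \<le> v" for u v
  proof -
    have "{\<omega> \<in> space M. real (\<sigma> u \<omega>) \<noteq> real (\<sigma> v \<omega>)} \<in> sets M"
      using \<sigma>_borel that by (intro borel_measurable_neq)
    then have "Measurable.pred M (\<lambda>\<omega>. \<sigma> u \<omega> \<noteq> \<sigma> v \<omega>)"
      by (simp add: pred_def)
    then show ?thesis by measurable
  qed
  have "(\<lambda>\<omega>. real (num_switches (\<lambda>u. \<sigma> u \<omega>) t)) \<in> borel_measurable M"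
  proof (rule borel_measurable_LIMSEQ_real)
    show "(\<lambda>m. \<Sum>i<m. of_bool (\<sigma> (t * real (Suc i) / real m) \<omega> \<noteq> \<sigma> (t * real i / real m) \<omega>) :: real)
           \<longlonglongrightarrow> real (num_switches (\<lambda>u. \<sigma> u \<omega>) t)" if "\<omega> \<in> space M" for \<omega>
      using cadlag[OF that] \<open>0 \<le> t\<close> by (rule grid_changes_tendsto_num_switches)
    show "(\<lambda>\<omega>. \<Sum>i<m. of_bool (\<sigma> (t * real (Suc i) / real m) \<omega> \<noteq> \<sigma> (t * real i / real m) \<omega>) :: real)
           \<in> borel_measurable M" for m
      using \<open>0 \<le> t\<close> by (intro borel_measurable_sum changes) auto
  qed
  then have "(\<lambda>\<omega>. nat \<lfloor>real (num_switches (\<lambda>u. \<sigma> u \<omega>) t)\<rfloor>) \<in> measurable M (count_space UNIV)"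
    by measurable
  then show ?thesis by simp
qed

section \<open>Almost sure decay of the discounted gain\<close>

text \<open>
  Below \<open>m\<close> the powers of \<open>\<mu>\<close> are at most \<open>\<mu> ^ m\<close> and the
  probabilities at most \<open>1\<close>; from \<open>m\<close> on the tail bound turns the sum into part of the
  series of \<open>exp (\<mu> * a)\<close>.
\<close>

lemma (in prob_space) exponential_moment_bound:
  fixes K :: "'a \<Rightarrow> nat" and a q \<mu> :: real
  assumes K[measurable]: "K \<in> measurable M (count_space UNIV)"
    and tail: "\<And>k. k \<ge> m \<Longrightarrow> prob {\<omega> \<in> space M. K \<omega> = k} \<le> a ^ k * q / fact k"
    and "\<mu> \<ge> 1" "a \<ge> 0" "q \<ge> 0"
  shows "(\<integral>\<^sup>+\<omega>. ennreal (\<mu> ^ K \<omega>) \<partial>M) \<le> ennreal (real m * \<mu> ^ m + q * exp (\<mu> * a))"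
proof -
  define b where "b k = (if k \<in> {..<m} then \<mu> ^ m else 0) + q * ((\<mu> * a) ^ k /\<^sub>R fact k)" for k
  have b_sums: "b sums (real m * \<mu> ^ m + q * exp (\<mu> * a))"
    using sums_add[OF sums_If_finite_set[of "{..<m}" "\<lambda>_. \<mu> ^ m"] sums_mult[OF exp_converges[of "\<mu> * a"], of q]]
    by (simp add: b_def[abs_def])
  have b_nonneg: "0 \<le> b k" for k
    using assms by (auto simp: b_def)
  have "ennreal (\<mu> ^ K \<omega>) = (\<Sum>k. ennreal (\<mu> ^ k) * indicator {\<omega> \<in> space M. K \<omega> = k} \<omega>)"
    if "\<omega> \<in> space M" for \<omega>
    using that by (subst suminf_finite[of "{K \<omega>}"]) (auto simp: indicator_def)
  then have "(\<integral>\<^sup>+\<omega>. ennreal (\<mu> ^ K \<omega>) \<partial>M)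
      = (\<integral>\<^sup>+\<omega>. (\<Sum>k. ennreal (\<mu> ^ k) * indicator {\<omega> \<in> space M. K \<omega> = k} \<omega>) \<partial>M)"
    by (rule nn_integral_cong)
  also have "\<dots> = (\<Sum>k. \<integral>\<^sup>+\<omega>. ennreal (\<mu> ^ k) * indicator {\<omega> \<in> space M. K \<omega> = k} \<omega> \<partial>M)"
    by (rule nn_integral_suminf) measurable
  also have "\<dots> = (\<Sum>k. ennreal (\<mu> ^ k) * emeasure M {\<omega> \<in> space M. K \<omega> = k})"
    by (intro suminf_cong nn_integral_cmult_indicator) measurable
  also have "\<dots> \<le> (\<Sum>k. ennreal (b k))"
  proof (rule suminf_le)
    fix k
    have "\<mu> ^ k * prob {\<omega> \<in> space M. K \<omega> = k} \<le> b k"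
    proof (cases "k < m")
      case True
      have "\<mu> ^ k * prob {\<omega> \<in> space M. K \<omega> = k} \<le> \<mu> ^ m * 1"
        using True assms by (intro mult_mono power_increasing) auto
      also have "\<dots> \<le> b k" using True assms by (simp add: b_def)
      finally show ?thesis .
    next
      case False
      then have "\<mu> ^ k * prob {\<omega> \<in> space M. K \<omega> = k} \<le> \<mu> ^ k * (a ^ k * q / fact k)"
        using assms by (intro mult_left_mono tail) auto
      also have "\<dots> = b k"
        using False by (simp add: b_def power_mult_distrib divide_inverse)
      finally show ?thesis .
    qed
    then show "ennreal (\<mu> ^ k) * emeasure M {\<omega> \<in> space M. K \<omega> = k} \<le> ennreal (b k)"
      using assms by (simp add: emeasure_eq_measure ennreal_mult[symmetric] ennreal_leI)
  qed auto
  also have "\<dots> = ennreal (real m * \<mu> ^ m + q * exp (\<mu> * a))"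
    by (rule suminf_ennreal_eq[OF b_nonneg b_sums])
  finally show ?thesis .
qed

text \<open>
  The means are bounded by the sum of two convergent geometric series, so the sum of the gains has finite mean;
  hence it is finite almost surely, and its terms tend to \<open>0\<close>.
\<close>

lemma (in prob_space) discounted_gain_tendsto_zero_at_integers:
  fixes K :: "nat \<Rightarrow> 'a \<Rightarrow> nat"
  assumes K[measurable]: "\<And>n. K n \<in> measurable M (count_space UNIV)"
    and tail: "\<And>n k. k \<ge> m \<Longrightarrow>
      prob {\<omega> \<in> space M. K n \<omega> = k} \<le> (b * real n) ^ k * exp (- c * real n) / fact k"
    and "\<mu> \<ge> 1" "b \<ge> 0" "\<rho> > 0" "\<mu> * b < \<rho> + c"
  shows "AE \<omega> in M. (\<lambda>n. \<mu> ^ K n \<omega> * exp (- \<rho> * real n)) \<longlonglongrightarrow> 0"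
proof -
  define C where "C = real m * \<mu> ^ m"
  have "0 \<le> C" using \<open>\<mu> \<ge> 1\<close> by (simp add: C_def)
  define q where "q n = C * exp (- \<rho>) ^ n + exp (\<mu> * b - c - \<rho>) ^ n" for n
  have q_nonneg: "0 \<le> q n" for n using \<open>0 \<le> C\<close> by (simp add: q_def)
  have q_summable: "summable q"
    unfolding q_def using assms(5,6) by (intro summable_add summable_mult summable_geometric) auto
  have moment: "(\<integral>\<^sup>+\<omega>. ennreal (\<mu> ^ K n \<omega> * exp (- \<rho> * real n)) \<partial>M) \<le> ennreal (q n)" for n
  proof -
    have "(\<integral>\<^sup>+\<omega>. ennreal (\<mu> ^ K n \<omega> * exp (- \<rho> * real n)) \<partial>M)
        = (\<integral>\<^sup>+\<omega>. ennreal (exp (- \<rho> * real n)) * ennreal (\<mu> ^ K n \<omega>) \<partial>M)"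
      using \<open>\<mu> \<ge> 1\<close> by (intro nn_integral_cong) (simp add: ennreal_mult[symmetric] mult.commute)
    also have "\<dots> = ennreal (exp (- \<rho> * real n)) * (\<integral>\<^sup>+\<omega>. ennreal (\<mu> ^ K n \<omega>) \<partial>M)"
      by (intro nn_integral_cmult) measurable
    also have "\<dots> \<le> ennreal (exp (- \<rho> * real n)) * ennreal (C + exp (- c * real n) * exp (\<mu> * (b * real n)))"
      unfolding C_def using assms(3,4)
      by (intro mult_left_mono exponential_moment_bound K tail) auto
    also have "\<dots> = ennreal (exp (- \<rho> * real n) * (C + exp (- c * real n) * exp (\<mu> * (b * real n))))"
      using \<open>0 \<le> C\<close> by (intro ennreal_mult[symmetric]) auto
    also have "exp (- \<rho> * real n) * (C + exp (- c * real n) * exp (\<mu> * (b * real n))) = q n"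
      by (simp add: q_def distrib_left exp_of_nat_mult[symmetric] mult_exp_exp algebra_simps)
    finally show ?thesis .
  qed
  have "(\<integral>\<^sup>+\<omega>. (\<Sum>n. ennreal (\<mu> ^ K n \<omega> * exp (- \<rho> * real n))) \<partial>M)
      = (\<Sum>n. \<integral>\<^sup>+\<omega>. ennreal (\<mu> ^ K n \<omega> * exp (- \<rho> * real n)) \<partial>M)"
    by (rule nn_integral_suminf) measurable
  also have "\<dots> \<le> (\<Sum>n. ennreal (q n))"
    by (intro suminf_le moment) auto
  also have "\<dots> = ennreal (suminf q)"
    using q_nonneg q_summable by (simp add: suminf_ennreal2)
  finally have "(\<integral>\<^sup>+\<omega>. (\<Sum>n. ennreal (\<mu> ^ K n \<omega> * exp (- \<rho> * real n))) \<partial>M) \<noteq> \<infinity>"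
    by (auto simp: top_unique)
  then have "AE \<omega> in M. (\<Sum>n. ennreal (\<mu> ^ K n \<omega> * exp (- \<rho> * real n))) \<noteq> \<infinity>"
    by (intro nn_integral_PInf_AE) measurable
  then show ?thesis
  proof eventually_elim
    case (elim \<omega>)
    then have "summable (\<lambda>n. \<mu> ^ K n \<omega> * exp (- \<rho> * real n))"
      using \<open>\<mu> \<ge> 1\<close> by (intro summable_suminf_not_top) auto
    then show ?case by (rule summable_LIMSEQ_zero)
  qed
qed

text \<open>
  The gain at \<open>t\<close> is at most \<open>exp \<rho>\<close> times the gain at the next integer, because
  the count only grows and the discount over less than one unit of time is at least
  \<open>exp (- \<rho>)\<close>.
\<close>

lemma discounted_gain_tendsto_zero:
  fixes K :: "real \<Rightarrow> nat" and \<mu> \<rho> :: real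
  assumes K: "\<And>t t'. t \<le> t' \<Longrightarrow> K t \<le> K t'" and "\<mu> \<ge> 1" "\<rho> > 0"
    and lim: "(\<lambda>n. \<mu> ^ K (real n) * exp (- \<rho> * real n)) \<longlonglongrightarrow> 0"
  shows "((\<lambda>t. \<mu> ^ K t * exp (- \<rho> * t)) \<longlongrightarrow> 0) at_top"
proof (rule tendsto_sandwich[where f = "\<lambda>_. 0"])
  let ?n = "\<lambda>t :: real. nat \<lceil>t\<rceil>"
  let ?h = "\<lambda>n. \<mu> ^ K (real n) * exp (- \<rho> * real n)"
  have "filterlim ?n sequentially at_top"
    unfolding filterlim_at_top
  proof
    fix m
    show "eventually (\<lambda>t. m \<le> ?n t) at_top"
      using eventually_ge_at_top[of "real m"] by eventually_elim linarith
  qed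
  then have "((\<lambda>t. ?h (?n t)) \<longlongrightarrow> 0) at_top"
    by (rule filterlim_compose[OF lim])
  then show "((\<lambda>t. exp \<rho> * ?h (?n t)) \<longlongrightarrow> 0) at_top"
    using tendsto_mult_right_zero by blast
  show "eventually (\<lambda>t. \<mu> ^ K t * exp (- \<rho> * t) \<le> exp \<rho> * ?h (?n t)) at_top"
    using eventually_ge_at_top[of 0]
  proof eventually_elim
    case (elim t)
    have n: "t \<le> real (?n t)" "real (?n t) \<le> t + 1" using elim by linarith+
    have "exp (- \<rho> * t) \<le> exp (\<rho> + - \<rho> * real (?n t))"
      using mult_left_mono[OF n(2), of \<rho>] \<open>\<rho> > 0\<close> by (simp add: algebra_simps)
    then have "\<mu> ^ K t * exp (- \<rho> * t) \<le> \<mu> ^ K (real (?n t)) * exp (\<rho> + - \<rho> * real (?n t))"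
      using K[OF n(1)] \<open>\<mu> \<ge> 1\<close> by (intro mult_mono power_increasing) auto
    then show ?case unfolding exp_add by (simp add: mult_ac)
  qed
  show "eventually (\<lambda>t. 0 \<le> \<mu> ^ K t * exp (- \<rho> * t)) at_top"
    using \<open>\<mu> \<ge> 1\<close> by simp
qed simp

lemma (in prob_space) discounted_gain_tendsto_zero_AE:
  fixes \<sigma> :: "real \<Rightarrow> 'a \<Rightarrow> nat" and \<mu> \<rho> b c :: real
  assumes \<sigma>: "\<And>t. 0 \<le> t \<Longrightarrow> \<sigma> t \<in> measurable M (count_space A)"
      "\<And>\<omega>. \<omega> \<in> space M \<Longrightarrow> cadlag (\<lambda>t. \<sigma> t \<omega>)"
    and tail: "\<And>k t. k \<ge> m \<Longrightarrow> 0 \<le> t \<Longrightarrow>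
      prob {\<omega> \<in> space M. num_switches (\<lambda>u. \<sigma> u \<omega>) t = k} \<le> (b * t) ^ k * exp (- c * t) / fact k"
    and "\<mu> \<ge> 1" "b \<ge> 0" "\<rho> > 0" "\<mu> * b < \<rho> + c"
  shows "AE \<omega> in M. ((\<lambda>t. \<mu> ^ num_switches (\<lambda>u. \<sigma> u \<omega>) t * exp (- \<rho> * t)) \<longlongrightarrow> 0) at_top"
proof -
  have "AE \<omega> in M. (\<lambda>n. \<mu> ^ num_switches (\<lambda>u. \<sigma> u \<omega>) (real n) * exp (- \<rho> * real n)) \<longlonglongrightarrow> 0"
    using assms(4-) by (intro discounted_gain_tendsto_zero_at_integers[where c = c and b = b and m = m]
        num_switches_measurable[OF \<sigma>] tail) auto
  then show ?thesis
  proof (rule AE_mp, intro AE_I2 impI)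
    fix \<omega> assume "\<omega> \<in> space M"
      and "(\<lambda>n. \<mu> ^ num_switches (\<lambda>u. \<sigma> u \<omega>) (real n) * exp (- \<rho> * real n)) \<longlonglongrightarrow> 0"
    then show "((\<lambda>t. \<mu> ^ num_switches (\<lambda>u. \<sigma> u \<omega>) t * exp (- \<rho> * t)) \<longlongrightarrow> 0) at_top"
      using assms(4,6) num_switches_mono[OF \<sigma>(2)] by (intro discounted_gain_tendsto_zero) auto
  qed
qed

section \<open>Stability and attraction\<close>

text \<open>
  The events of the stability notion quantify over uncountably many initial conditions and times, and their
  measurability comes from completeness: they contain an event of probability \<open>1\<close>.
\<close>

lemma (in prob_space) prob_Collect_eq_1_complete:
  assumes "complete_measure M" "AE \<omega> in M. Q \<omega>"
  shows "prob {\<omega> \<in> space M. Q \<omega>} = 1"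
proof -
  obtain Z where Z: "{\<omega> \<in> space M. \<not> Q \<omega>} \<subseteq> Z" "Z \<in> null_sets M"
    using assms(2) unfolding eventually_ae_filter by blast
  then have "{\<omega> \<in> space M. \<not> Q \<omega>} \<in> sets M"
    by (rule complete_measure.complete[OF assms(1)])
  then have "space M - {\<omega> \<in> space M. \<not> Q \<omega>} \<in> sets M" by auto
  moreover have "space M - {\<omega> \<in> space M. \<not> Q \<omega>} = {\<omega> \<in> space M. Q \<omega>}" by auto
  ultimately show ?thesis
    using assms(2) by (subst prob_Collect_eq_1) auto
qed

context switched_lyapunov_system
begin

text \<open>
  Halving \<open>\<epsilon>\<close> leaves room for a strict bound on the supremum, which is taken in the
  extended reals.
\<close>

lemma SUP_norm_less:
  assumes "\<And>t. t \<in> S \<Longrightarrow> \<alpha>\<^sub>1 (norm (x t)) \<le> \<alpha>\<^sub>1 (\<epsilon> / 2)" "\<epsilon> > 0"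
  shows "(SUP t\<in>S. ereal (norm (x t))) < ereal \<epsilon>"
proof -
  have "norm (x t) \<le> \<epsilon> / 2" if "t \<in> S" for t
    using assms(1)[OF that] \<alpha>\<^sub>1_mono[of "\<epsilon> / 2" "norm (x t)"] assms(2) by force
  then have "(SUP t\<in>S. ereal (norm (x t))) \<le> ereal (\<epsilon> / 2)"
    by (intro SUP_least) auto
  also have "\<dots> < ereal \<epsilon>" using assms(2) by simp
  finally show ?thesis .
qed

lemma \<alpha>\<^sub>1_pos: "0 < r \<Longrightarrow> 0 < \<alpha>\<^sub>1 r"
  using \<alpha>\<^sub>1_mono[of 0 r] \<alpha>\<^sub>1_nonneg[of 0] by auto

text \<open>
  The gain is below \<open>1\<close> from some time \<open>T\<close> on and at most
  \<open>\<mu> ^ num_switches s T\<close> before, hence bounded by a constant that does not depend on the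
  initial condition; continuity of \<open>\<alpha>\<^sub>2\<close> at \<open>0\<close> does the rest.
\<close>

lemma uniform_stability_of_path:
  fixes x :: "real ^ 'n \<Rightarrow> real \<Rightarrow> real ^ 'n"
  assumes s: "cadlag s"
    and bound: "\<And>x0 t. 0 \<le> t \<Longrightarrow> \<alpha>\<^sub>1 (norm (x x0 t)) \<le> \<mu> ^ num_switches s t * exp (- \<rho> * t) * \<alpha>\<^sub>2 (norm x0)"
    and lim: "((\<lambda>t. \<mu> ^ num_switches s t * exp (- \<rho> * t)) \<longlongrightarrow> 0) at_top"
    and \<alpha>\<^sub>2: "class_K \<alpha>\<^sub>2" and "\<epsilon> > 0"
  shows "\<exists>\<delta>>0. \<forall>x0. norm x0 < \<delta> \<longrightarrow> (SUP t\<in>{0..}. ereal (norm (x x0 t))) < ereal \<epsilon>"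
proof -
  let ?g = "\<lambda>t. \<mu> ^ num_switches s t * exp (- \<rho> * t)"
  have "eventually (\<lambda>t. ?g t < 1) at_top"
    using lim by (rule order_tendstoD) simp
  then obtain T where T: "\<And>t. t \<ge> T \<Longrightarrow> ?g t < 1"
    by (auto simp: eventually_at_top_linorder)
  define B where "B = \<mu> ^ num_switches s T"
  have "B \<ge> 1" using gain_ge_1 by (simp add: B_def)
  have g_le: "?g t \<le> B" if "0 \<le> t" for t
  proof (cases "t \<le> T")
    case True
    have "?g t \<le> \<mu> ^ num_switches s T * 1"
      using num_switches_mono[OF s True] gain_ge_1 rate_pos that
      by (intro mult_mono power_increasing) auto
    then show ?thesis by (simp add: B_def)
  next
    case False
    then show ?thesis using T[of t] \<open>B \<ge> 1\<close> by auto
  qed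
  have "continuous_on {0..} \<alpha>\<^sub>2" "\<alpha>\<^sub>2 0 = 0" using \<alpha>\<^sub>2 by (auto simp: class_K_def)
  moreover have "\<alpha>\<^sub>1 (\<epsilon> / 2) / B > 0" using \<alpha>\<^sub>1_pos[of "\<epsilon> / 2"] \<open>\<epsilon> > 0\<close> \<open>B \<ge> 1\<close> by simp
  ultimately obtain \<delta> where \<delta>: "\<delta> > 0" "\<And>r. 0 \<le> r \<Longrightarrow> r < \<delta> \<Longrightarrow> \<bar>\<alpha>\<^sub>2 r\<bar> < \<alpha>\<^sub>1 (\<epsilon> / 2) / B"
    unfolding continuous_on_iff by (force simp: dist_real_def)
  show ?thesis
  proof (intro exI[of _ \<delta>] conjI allI impI SUP_norm_less)
    fix x0 :: "real ^ 'n" and t :: real assume x0: "norm x0 < \<delta>" and "t \<in> {0..}"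
    then have "\<alpha>\<^sub>1 (norm (x x0 t)) \<le> ?g t * \<alpha>\<^sub>2 (norm x0)" using bound by simp
    also have "\<dots> \<le> ?g t * \<bar>\<alpha>\<^sub>2 (norm x0)\<bar>"
      using gain_ge_1 by (intro mult_left_mono) auto
    also have "\<dots> \<le> B * (\<alpha>\<^sub>1 (\<epsilon> / 2) / B)"
      using g_le[of t] \<open>t \<in> {0..}\<close> \<delta>(2)[of "norm x0"] x0 \<open>B \<ge> 1\<close> by (intro mult_mono) auto
    also have "\<dots> = \<alpha>\<^sub>1 (\<epsilon> / 2)" using \<open>B \<ge> 1\<close> by simp
    finally show "\<alpha>\<^sub>1 (norm (x x0 t)) \<le> \<alpha>\<^sub>1 (\<epsilon> / 2)" .
  qed (use \<delta> \<open>\<epsilon> > 0\<close> in auto)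
qed

text \<open>
  The initial condition enters the bound only through \<open>\<alpha>\<^sub>2 (norm x0)\<close>, which
  \<open>\<alpha>\<^sub>2 r\<close> dominates; so one time serves all initial conditions in the ball.
\<close>

lemma uniform_attraction_of_path:
  fixes x :: "real ^ 'n \<Rightarrow> real \<Rightarrow> real ^ 'n"
  assumes bound: "\<And>x0 t. 0 \<le> t \<Longrightarrow> \<alpha>\<^sub>1 (norm (x x0 t)) \<le> \<mu> ^ num_switches s t * exp (- \<rho> * t) * \<alpha>\<^sub>2 (norm x0)"
    and lim: "((\<lambda>t. \<mu> ^ num_switches s t * exp (- \<rho> * t)) \<longlongrightarrow> 0) at_top"
    and \<alpha>\<^sub>2: "class_K \<alpha>\<^sub>2" and "\<epsilon> > 0"
  shows "\<exists>T\<ge>0. \<forall>x0. norm x0 < r \<longrightarrow> (SUP t\<in>{T..}. ereal (norm (x x0 t))) < ereal \<epsilon>"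
proof -
  let ?g = "\<lambda>t. \<mu> ^ num_switches s t * exp (- \<rho> * t)"
  have "((\<lambda>t. ?g t * \<alpha>\<^sub>2 r) \<longlongrightarrow> 0) at_top"
    using lim by (rule tendsto_mult_left_zero)
  then have "eventually (\<lambda>t. ?g t * \<alpha>\<^sub>2 r < \<alpha>\<^sub>1 (\<epsilon> / 2)) at_top"
    using \<alpha>\<^sub>1_pos[of "\<epsilon> / 2"] \<open>\<epsilon> > 0\<close> by (intro order_tendstoD) auto
  then obtain T where T: "\<And>t. t \<ge> T \<Longrightarrow> ?g t * \<alpha>\<^sub>2 r < \<alpha>\<^sub>1 (\<epsilon> / 2)"
    by (auto simp: eventually_at_top_linorder)
  show ?thesis
  proof (intro exI[of _ "max 0 T"] conjI allI impI SUP_norm_less)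
    fix x0 :: "real ^ 'n" and t assume x0: "norm x0 < r" and t: "t \<in> {max 0 T..}"
    have "\<alpha>\<^sub>2 (norm x0) < \<alpha>\<^sub>2 r"
      using \<alpha>\<^sub>2 x0 norm_ge_zero[of x0] unfolding class_K_def by (auto intro!: strict_mono_onD[of "{0..}" \<alpha>\<^sub>2] simp del: norm_ge_zero)
    then have "?g t * \<alpha>\<^sub>2 (norm x0) \<le> ?g t * \<alpha>\<^sub>2 r"
      using gain_ge_1 by (intro mult_left_mono) auto
    then show "\<alpha>\<^sub>1 (norm (x x0 t)) \<le> \<alpha>\<^sub>1 (\<epsilon> / 2)"
      using bound[of t x0] T[of t] t by auto
  qed (use \<open>\<epsilon> > 0\<close> in auto)
qed

end

theorem theorem3p1:
  fixes M :: "'w measure"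
    and F :: "real \<Rightarrow> 'w set set"
    and N :: nat
    and f :: "nat \<Rightarrow> (real ^ 'n) \<Rightarrow> (real ^ 'n)"
    and \<sigma> :: "real \<Rightarrow> 'w \<Rightarrow> nat"
    and V :: "nat \<Rightarrow> (real ^ 'n) \<Rightarrow> real"
    and \<alpha>\<^sub>1 \<alpha>\<^sub>2 :: "real \<Rightarrow> real"
    and lam_tilde lam_bar lam0 \<mu> :: real
  assumes system: "randomly_switched_system M F N f \<sigma>"
    and V_C1: "\<And>p. p \<in> {1..N} \<Longrightarrow> continuously_differentiable (V p)"
    and V_nonneg: "\<And>p x. p \<in> {1..N} \<Longrightarrow> 0 \<le> V p x"
    and \<alpha>: "class_K_inf \<alpha>\<^sub>1" "class_K_inf \<alpha>\<^sub>2"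
    and params: "lam_tilde > 0" "lam_bar > 0" "lam0 > 0" "\<mu> > 1"
    and i: "\<And>p x. p \<in> {1..N} \<Longrightarrow> \<alpha>\<^sub>1 (norm x) \<le> V p x \<and> V p x \<le> \<alpha>\<^sub>2 (norm x)"
    and ii: "\<And>p x. p \<in> {1..N} \<Longrightarrow> frechet_derivative (V p) (at x) (f p x) \<le> - lam0 * V p x"
    and iii: "\<And>p1 p2 x. p1 \<in> {1..N} \<Longrightarrow> p2 \<in> {1..N} \<Longrightarrow> V p1 x \<le> \<mu> * V p2 x"
    and iv: "\<exists>M0::nat. \<forall>k\<ge>M0. \<forall>t\<ge>0.
        measure M {\<omega> \<in> space M. num_switches (\<lambda>u. \<sigma> u \<omega>) t = k}
          \<le> (lam_bar * t) ^ k * exp (- lam_tilde * t) / fact k"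
    and v: "\<mu> < (lam0 + lam_tilde) / lam_bar"
  shows "globally_asymptotically_stable_as M f \<sigma>"
proof -
  interpret randomly_switched_system M F N f \<sigma> by (rule system)
  interpret sys: switched_lyapunov_system "{1..N}" f V \<alpha>\<^sub>1 \<alpha>\<^sub>2 lam0 \<mu>
  proof
    show "V p differentiable at x" if "p \<in> {1..N}" for p x
      using V_C1[OF that] unfolding continuously_differentiable_def differentiable_def by blast
  qed (use f_lipschitz \<alpha> params i ii iii in auto)
  have \<sigma>_values: "\<sigma> t \<omega> \<in> {1..N}" if "0 \<le> t" "\<omega> \<in> space M" for t \<omega>
    using measurable_space[OF \<sigma>_measurable] that by simp
  let ?gain = "\<lambda>\<omega> t. \<mu> ^ num_switches (\<lambda>u. \<sigma> u \<omega>) t * exp (- lam0 * t)"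
  define is_solution where "is_solution x0 \<omega> x \<longleftrightarrow> unique_caratheodory_solution f (\<lambda>t. \<sigma> t \<omega>) x0 x
      \<and> (\<forall>t\<ge>0. \<alpha>\<^sub>1 (norm (x t)) \<le> ?gain \<omega> t * \<alpha>\<^sub>2 (norm x0))" for x0 \<omega> x
  define X where "X x0 \<omega> = (SOME x. is_solution x0 \<omega> x)" for x0 \<omega>
  have "is_solution x0 \<omega> (X x0 \<omega>)" if "\<omega> \<in> space M" for x0 \<omega>
  proof -
    have "\<exists>x. is_solution x0 \<omega> x"
      using sys.global_solution[OF \<sigma>_cadlag[OF that] \<sigma>_values[OF _ that], of x0]
      unfolding is_solution_def by blast
    then show ?thesis unfolding X_def by (rule someI_ex)
  qed
  then have X: "\<omega> \<in> space M \<Longrightarrow> unique_caratheodory_solution f (\<lambda>t. \<sigma> t \<omega>) x0 (X x0 \<omega>)"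
    "\<omega> \<in> space M \<Longrightarrow> 0 \<le> t \<Longrightarrow> \<alpha>\<^sub>1 (norm (X x0 \<omega> t)) \<le> ?gain \<omega> t * \<alpha>\<^sub>2 (norm x0)" for x0 \<omega> t
    unfolding is_solution_def by blast+
  obtain M0 where "\<And>k t. k \<ge> M0 \<Longrightarrow> 0 \<le> t \<Longrightarrow>
      prob {\<omega> \<in> space M. num_switches (\<lambda>u. \<sigma> u \<omega>) t = k} \<le> (lam_bar * t) ^ k * exp (- lam_tilde * t) / fact k"
    using iv by blast
  then have gain: "AE \<omega> in M. (?gain \<omega> \<longlongrightarrow> 0) at_top"
    using params v by (intro discounted_gain_tendsto_zero_AE[OF \<sigma>_measurable \<sigma>_cadlag]) (auto simp: pos_less_divide_eq)
  have \<alpha>\<^sub>2: "class_K \<alpha>\<^sub>2" using \<alpha>(2) by (simp add: class_K_inf_def)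
  have stable: "\<forall>\<epsilon>>0. \<exists>\<delta>>0. \<forall>x0. norm x0 < \<delta> \<longrightarrow> (SUP t\<in>{0..}. ereal (norm (X x0 \<omega> t))) < ereal \<epsilon>"
    if "\<omega> \<in> space M" "(?gain \<omega> \<longlongrightarrow> 0) at_top" for \<omega>
    using sys.uniform_stability_of_path[where x = "\<lambda>x0. X x0 \<omega>", OF \<sigma>_cadlag[OF that(1)] X(2)[OF that(1)] that(2) \<alpha>\<^sub>2]
    by blast
  have attractive: "\<forall>r>0. \<forall>\<epsilon>>0. \<exists>T\<ge>0. \<forall>x0. norm x0 < r \<longrightarrow> (SUP t\<in>{T..}. ereal (norm (X x0 \<omega> t))) < ereal \<epsilon>"
    if "\<omega> \<in> space M" "(?gain \<omega> \<longlongrightarrow> 0) at_top" for \<omega>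
    using sys.uniform_attraction_of_path[where x = "\<lambda>x0. X x0 \<omega>", OF X(2)[OF that(1)] that(2) \<alpha>\<^sub>2]
    by blast
  have "SP1 M X"
    unfolding SP1_def
    by (rule prob_Collect_eq_1_complete[OF complete_space AE_mp[OF gain]]) (rule AE_I2, rule impI, rule stable)
  moreover have "SP2 M X"
    unfolding SP2_def
    by (rule prob_Collect_eq_1_complete[OF complete_space AE_mp[OF gain]]) (rule AE_I2, rule impI, rule attractive)
  ultimately show ?thesis
    unfolding globally_asymptotically_stable_as_def using X(1) by blast
qed

end
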